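(* Let $\mathcal{X}_j=\{\mathcal{P}_j=0\}$, $j=1,\dots,n$, be $n$ hypersurfaces in $\mathbf{P}^n(\mathbf{C})$ defined by homogeneous polynomials $\mathcal{P}_j$ in the $n+1$ variables $X_0,\dots,X_n$. Let $P_j(X_1,\dots,X_n)=\mathcal{P}_j(1,X_1,\dots,X_n)$, and assume there exist constants $c>0$, $R>0$ and rational numbers $0<\delta_j\le\deg P_j$, $j=1,\dots,n$, such that for every $\zeta\in\mathbf{C}^n$ with $\|\zeta\|\ge R$, $$\sum_{j=1}^n\frac{|P_j(\zeta)|}{(1+\|\zeta\|^2)^{\delta_j/2}}\ge c .$$ Suppose also that all common zeroes of $P_1,\dots,P_n$ in $\mathbf{C}^n$ are simple. Let $\mathcal{Z}=(\mathcal{X}_1\cap\cdots\cap\mathcal{X}_n)\setminus\{X_0=0\}\subset\mathbf{C}^n$, and let $\mathcal{Y}$ be any hypersurface in $\mathbf{P}^n(\mathbf{C})$ of degree at most $\delta_1+\cdots+\delta_n-n-1$. If $\mathcal{Y}$ contains all points of $\mathcal{Z}$ except possibly one, then $\mathcal{Y}$ contains all points of $\mathcal{Z}$.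
   Context: $\mathbf{C}^n$ is identified with the open subset $\{X_0\neq0\}$ of $\mathbf{P}^n(\mathbf{C})$ via $(\zeta_1,\dots,\zeta_n)\mapsto[1:\zeta_1:\cdots:\zeta_n]$. A common zero $\alpha$ of $P_1,\dots,P_n$ is simple if the Jacobian determinant $\det(\partial P_j/\partial X_k)$ does not vanish at $\alpha$. $\|\cdot\|$ is the Euclidean norm. *)

theory Defs
  imports "HOL-Analysis.Analysis" "HOL-Library.Poly_Mapping"
begin

section \<open>Complex polynomials in finitely many variables\<close>

text \<open>
  Polynomials are finitely supported coefficient functions on monomials (exponent vectors);
  the ring structure is the convolution structure of \<^theory>\<open>HOL-Library.Poly_Mapping\<close>.
  The variables are indexed by a finite type: \<open>'n\<close> for \<open>X\<^sub>1, \<dots>, X\<^sub>n\<close>, and \<open>'n option\<close> for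
  \<open>X\<^sub>0, X\<^sub>1, \<dots>, X\<^sub>n\<close>, where \<open>None\<close> is the index of \<open>X\<^sub>0\<close>.
\<close>

type_synonym 'v cpoly = "('v \<Rightarrow>\<^sub>0 nat) \<Rightarrow>\<^sub>0 complex"

definition pvar :: "'v \<Rightarrow> 'v cpoly" where
  "pvar v = Poly_Mapping.single (Poly_Mapping.single v 1) 1"

definition peval :: "'v::finite cpoly \<Rightarrow> complex ^ 'v \<Rightarrow> complex" where
  "peval p x = (\<Sum>m\<in>Poly_Mapping.keys p.
     Poly_Mapping.lookup p m * (\<Prod>v\<in>UNIV. (x $ v) ^ Poly_Mapping.lookup m v))"

definition monom_degree :: "('v::finite \<Rightarrow>\<^sub>0 nat) \<Rightarrow> nat" where
  "monom_degree m = (\<Sum>v\<in>UNIV. Poly_Mapping.lookup m v)"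

text \<open>The zero polynomial gets degree 0.\<close>

definition total_degree :: "'v::finite cpoly \<Rightarrow> nat" where
  "total_degree p = Max (insert 0 (monom_degree ` Poly_Mapping.keys p))"

definition homogeneous :: "nat \<Rightarrow> 'v::finite cpoly \<Rightarrow> bool" where
  "homogeneous d p \<longleftrightarrow> (\<forall>m\<in>Poly_Mapping.keys p. monom_degree m = d)"

definition partial_deriv :: "'v \<Rightarrow> 'v cpoly \<Rightarrow> 'v cpoly" where
  "partial_deriv k p = (\<Sum>m\<in>Poly_Mapping.keys p.
     Poly_Mapping.single (m - Poly_Mapping.single k 1)
       (of_nat (Poly_Mapping.lookup m k) * Poly_Mapping.lookup p m))"

text \<open>The substitution \<open>X\<^sub>0 := 1\<close>, which forgets the exponent of \<open>X\<^sub>0\<close> in every monomial.\<close>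

definition dehomogenize :: "'n option cpoly \<Rightarrow> 'n cpoly" where
  "dehomogenize p = (\<Sum>m\<in>Poly_Mapping.keys p.
     Poly_Mapping.single (Poly_Mapping.map_key Some m) (Poly_Mapping.lookup p m))"

definition jacobian_matrix :: "('n \<Rightarrow> 'n::finite cpoly) \<Rightarrow> complex ^ 'n \<Rightarrow> complex ^ 'n ^ 'n" where
  "jacobian_matrix P \<alpha> = (\<chi> j k. peval (partial_deriv k (P j)) \<alpha>)"


section \<open>Projective space and hypersurfaces\<close>

definition proj_rel :: "complex ^ 'v \<Rightarrow> complex ^ 'v \<Rightarrow> bool" where
  "proj_rel x y \<longleftrightarrow> x \<noteq> 0 \<and> y \<noteq> 0 \<and> (\<exists>c. c \<noteq> 0 \<and> y = c *s x)"

lemma part_equivp_proj_rel: "part_equivp (proj_rel :: complex ^ 'v \<Rightarrow> complex ^ 'v \<Rightarrow> bool)"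
proof (rule part_equivpI)
  have "proj_rel (vec 1 :: complex ^ 'v) (vec 1)"
    unfolding proj_rel_def by (auto simp: vec_eq_iff intro!: exI[of _ 1])
  then show "\<exists>x :: complex ^ 'v. proj_rel x x" ..
  show "symp (proj_rel :: complex ^ 'v \<Rightarrow> _)"
  proof (rule sympI)
    fix x y :: "complex ^ 'v"
    assume "proj_rel x y"
    then obtain c where c: "x \<noteq> 0" "y \<noteq> 0" "c \<noteq> 0" "y = c *s x"
      unfolding proj_rel_def by blast
    then have "x = inverse c *s y" by (simp add: vec_eq_iff)
    moreover have "inverse c \<noteq> 0" using c by simp
    ultimately show "proj_rel y x"
      using c(1,2) unfolding proj_rel_def by blast
  qed
  show "transp (proj_rel :: complex ^ 'v \<Rightarrow> _)"
  proof (rule transpI)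
    fix x y z :: "complex ^ 'v"
    assume "proj_rel x y" "proj_rel y z"
    then obtain a b where "x \<noteq> 0" "z \<noteq> 0" "a \<noteq> 0" "b \<noteq> 0" "y = a *s x" "z = b *s y"
      unfolding proj_rel_def by blast
    then show "proj_rel x z"
      unfolding proj_rel_def by (auto simp: vector_smult_assoc intro!: exI[of _ "b * a"])
  qed
qed

text \<open>\<open>'n option proj\<close> is \<open>\<^bold>P\<^sup>n(\<^bold>C)\<close>; \<open>proj_pt x\<close> is the point with homogeneous coordinates \<open>x \<noteq> 0\<close>.\<close>

quotient_type 'v proj = "complex ^ 'v" / partial: proj_rel
  morphisms rep_proj proj_pt
  by (rule part_equivp_proj_rel)

definition proj_zeros :: "'v::finite cpoly \<Rightarrow> 'v proj set" where
  "proj_zeros p = {proj_pt x | x. x \<noteq> 0 \<and> peval p x = 0}"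

definition is_hypersurface :: "nat \<Rightarrow> 'v::finite proj set \<Rightarrow> bool" where
  "is_hypersurface d Y \<longleftrightarrow> (\<exists>q. d > 0 \<and> q \<noteq> 0 \<and> homogeneous d q \<and> Y = proj_zeros q)"

definition affine_embed :: "complex ^ 'n \<Rightarrow> 'n::finite option proj" where
  "affine_embed \<zeta> = proj_pt (\<chi> v. case v of None \<Rightarrow> 1 | Some k \<Rightarrow> \<zeta> $ k)"


section \<open>Basic facts\<close>

lemma peval_scale:
  assumes "homogeneous d p"
  shows "peval p (c *s x) = c ^ d * peval p x"
proof -
  have "Poly_Mapping.lookup p m * (\<Prod>v\<in>UNIV. ((c *s x) $ v) ^ Poly_Mapping.lookup m v) =
        c ^ d * (Poly_Mapping.lookup p m * (\<Prod>v\<in>UNIV. (x $ v) ^ Poly_Mapping.lookup m v))"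
    if "m \<in> Poly_Mapping.keys p" for m
  proof -
    have "d = (\<Sum>v\<in>UNIV. Poly_Mapping.lookup m v)"
      using assms that by (simp add: homogeneous_def monom_degree_def)
    then show ?thesis
      by (simp add: power_mult_distrib prod.distrib power_sum)
  qed
  then show ?thesis
    unfolding peval_def sum_distrib_left by (rule sum.cong[OF refl])
qed

lemma proj_pt_in_proj_zeros_iff:
  assumes "homogeneous d p" and "x \<noteq> 0"
  shows "proj_pt x \<in> proj_zeros p \<longleftrightarrow> peval p x = 0"
proof
  assume "proj_pt x \<in> proj_zeros p"
  then obtain y where y: "y \<noteq> 0" "peval p y = 0" "proj_pt x = proj_pt y"
    unfolding proj_zeros_def by blast
  have refl: "proj_rel z z" if "z \<noteq> 0" for z :: "complex ^ 'a"
    using that unfolding proj_rel_def by (auto intro!: exI[of _ 1])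
  have "proj_rel x y"
    using Quotient3_rel[OF Quotient3_proj, of x y] y refl assms(2) by blast
  then obtain c where "c \<noteq> 0" "y = c *s x" unfolding proj_rel_def by blast
  with y(2) peval_scale[OF assms(1)] show "peval p x = 0" by simp
next
  assume "peval p x = 0"
  with assms(2) show "proj_pt x \<in> proj_zeros p" unfolding proj_zeros_def by blast
qed

lemma peval_sum_single:
  assumes "finite A"
  shows "peval (\<Sum>a\<in>A. Poly_Mapping.single (f a) (g a)) x =
         (\<Sum>a\<in>A. g a * (\<Prod>v\<in>UNIV. (x $ v) ^ Poly_Mapping.lookup (f a) v))"
proof -
  let ?M = "\<lambda>m. \<Prod>v\<in>UNIV. (x $ v) ^ Poly_Mapping.lookup m v"
  let ?p = "\<Sum>a\<in>A. Poly_Mapping.single (f a) (g a)"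
  have lk: "Poly_Mapping.lookup ?p m = (\<Sum>a\<in>A. if f a = m then g a else 0)" for m
    by (simp add: lookup_sum lookup_single when_def)
  have sub: "Poly_Mapping.keys ?p \<subseteq> f ` A"
  proof
    fix m assume "m \<in> Poly_Mapping.keys ?p"
    then have "(\<Sum>a\<in>A. if f a = m then g a else 0) \<noteq> 0"
      by (simp add: in_keys_iff lk)
    then obtain a where "a \<in> A" "(if f a = m then g a else 0) \<noteq> 0"
      by (rule sum.not_neutral_contains_not_neutral)
    then show "m \<in> f ` A" by (auto split: if_splits)
  qed
  have "peval ?p x = (\<Sum>m\<in>f ` A. Poly_Mapping.lookup ?p m * ?M m)"
    unfolding peval_def using assms sub
    by (intro sum.mono_neutral_left) (auto simp: in_keys_iff)
  also have "\<dots> = (\<Sum>m\<in>f ` A. \<Sum>a\<in>A. if f a = m then g a * ?M (f a) else 0)"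
    unfolding lk sum_distrib_right by (intro sum.cong refl) auto
  also have "\<dots> = (\<Sum>a\<in>A. \<Sum>m\<in>f ` A. if f a = m then g a * ?M (f a) else 0)"
    by (rule sum.swap)
  also have "\<dots> = (\<Sum>a\<in>A. g a * ?M (f a))"
    using assms by (intro sum.cong refl) (simp add: sum.delta)
  finally show ?thesis .
qed

lemma peval_pvar [simp]: "peval (pvar v) x = x $ v"
proof -
  have "(\<Prod>w\<in>UNIV. (x $ w) ^ Poly_Mapping.lookup (Poly_Mapping.single v 1) w) =
        (\<Prod>w\<in>UNIV. if w = v then x $ w else 1)"
    by (intro prod.cong refl) (simp add: lookup_single when_def)
  then show ?thesis
    by (simp add: peval_def pvar_def prod.delta)
qed

lemma peval_dehomogenize:
  "peval (dehomogenize p) \<zeta> = peval p (\<chi> v. case v of None \<Rightarrow> 1 | Some k \<Rightarrow> \<zeta> $ k)"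
proof -
  have inj: "inj (Some :: 'a \<Rightarrow> 'a option)" by simp
  have "(\<Prod>v\<in>UNIV. (\<zeta> $ v) ^ Poly_Mapping.lookup (Poly_Mapping.map_key Some m) v) =
        (\<Prod>v\<in>UNIV. (case v of None \<Rightarrow> 1 | Some k \<Rightarrow> \<zeta> $ k) ^ Poly_Mapping.lookup m v)" for m
    by (simp add: UNIV_option_conv prod.reindex map_key.rep_eq[OF inj])
  then show ?thesis
    unfolding dehomogenize_def by (simp add: peval_sum_single) (simp add: peval_def)
qed

lemma has_field_derivative_peval:
  "((\<lambda>t. peval p (\<chi> v. if v = k then t else x $ v)) has_field_derivative
     peval (partial_deriv k p) x) (at (x $ k))"
proof -
  let ?r = "\<lambda>m. \<Prod>v\<in>UNIV - {k}. (x $ v) ^ Poly_Mapping.lookup m v"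
  have split: "(\<Prod>v\<in>UNIV. g v) = g k * (\<Prod>v\<in>UNIV - {k}. g v)" for g :: "'a \<Rightarrow> complex"
    by (simp add: prod.remove)
  have A: "peval p (\<chi> v. if v = k then t else x $ v) =
      (\<Sum>m\<in>Poly_Mapping.keys p.
         Poly_Mapping.lookup p m * (t ^ Poly_Mapping.lookup m k * ?r m))" for t
    unfolding peval_def split by (intro sum.cong refl) simp
  have B: "peval (partial_deriv k p) x =
      (\<Sum>m\<in>Poly_Mapping.keys p. Poly_Mapping.lookup p m *
         (of_nat (Poly_Mapping.lookup m k) * (x $ k) ^ (Poly_Mapping.lookup m k - 1) * ?r m))"
    unfolding partial_deriv_def peval_sum_single[OF finite_keys] split
    by (intro sum.cong refl) (simp add: lookup_minus lookup_single when_def)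
  show ?thesis
    unfolding A B by (auto intro!: derivative_eq_intros sum.cong)
qed

lemma affine_part_eq:
  fixes \<P> :: "'n::finite \<Rightarrow> 'n option cpoly"
  assumes "\<And>j. homogeneous (d j) (\<P> j)"
  shows "(\<Inter>j. proj_zeros (\<P> j)) - proj_zeros (pvar None) =
         affine_embed ` {\<zeta>. \<forall>j. peval (dehomogenize (\<P> j)) \<zeta> = 0}"
proof -
  let ?e = "\<lambda>\<zeta>::complex^'n. (\<chi> v. case v of None \<Rightarrow> 1 | Some k \<Rightarrow> \<zeta> $ k) :: complex ^ 'n option"
  have e0: "?e \<zeta> \<noteq> 0" for \<zeta> by (auto simp: vec_eq_iff intro!: exI[of _ None])
  have hv: "homogeneous 1 (pvar (None :: 'n option))"
    by (simp add: homogeneous_def pvar_def monom_degree_def lookup_single when_def sum.delta)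
  have mem: "affine_embed \<zeta> \<in> proj_zeros (\<P> j) \<longleftrightarrow> peval (dehomogenize (\<P> j)) \<zeta> = 0" for \<zeta> j
    unfolding affine_embed_def peval_dehomogenize
    by (rule proj_pt_in_proj_zeros_iff[OF assms e0])
  have nm: "affine_embed \<zeta> \<notin> proj_zeros (pvar None)" for \<zeta> :: "complex ^ 'n"
    unfolding affine_embed_def proj_pt_in_proj_zeros_iff[OF hv e0] by simp
  have ex: "\<exists>\<zeta>. z = affine_embed \<zeta>"
    if z: "z \<in> proj_zeros (\<P> j)" "z \<notin> proj_zeros (pvar None)" for z j
  proof -
    from z(1) obtain x where x: "z = proj_pt x" "x \<noteq> 0" unfolding proj_zeros_def by blast
    with z(2) proj_pt_in_proj_zeros_iff[OF hv x(2)] have n: "x $ None \<noteq> 0" by simp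
    let ?\<zeta> = "(\<chi> k. x $ Some k / x $ None) :: complex ^ 'n"
    have "?e ?\<zeta> = inverse (x $ None) *s x"
      using n by (auto simp: vec_eq_iff field_simps split: option.split)
    moreover have "inverse (x $ None) \<noteq> 0" using n by simp
    ultimately have "proj_rel x (?e ?\<zeta>)"
      using x(2) e0[of ?\<zeta>] unfolding proj_rel_def by blast
    then have "proj_pt x = proj_pt (?e ?\<zeta>)"
      using Quotient3_rel[OF Quotient3_proj] by blast
    then show ?thesis using x(1) unfolding affine_embed_def by blast
  qed
  show ?thesis
  proof (intro equalityI subsetI)
    fix z assume z: "z \<in> (\<Inter>j. proj_zeros (\<P> j)) - proj_zeros (pvar None)"
    then obtain \<zeta> where "z = affine_embed \<zeta>" using ex by blast
    with z mem show "z \<in> affine_embed ` {\<zeta>. \<forall>j. peval (dehomogenize (\<P> j)) \<zeta> = 0}" by blast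
  next
    fix z assume "z \<in> affine_embed ` {\<zeta>. \<forall>j. peval (dehomogenize (\<P> j)) \<zeta> = 0}"
    with mem nm show "z \<in> (\<Inter>j. proj_zeros (\<P> j)) - proj_zeros (pvar None)" by blast
  qed
qed

end

theory Submission
  imports Defs
begin

text \<open>
  Write \<open>J\<close> for the Jacobian determinant of \<open>P = (P\<^sub>1, \<dots>, P\<^sub>n)\<close> and \<open>Q\<close> for the affine equation of
  the hypersurface. Growth makes \<open>P\<close> proper, so for radii \<open>\<rho>\<^sub>j > 0\<close> the weight
  \<open>w\<^sub>\<rho> = \<Prod>\<^sub>j b(|P\<^sub>j|\<^sup>2 / \<rho>\<^sub>j\<^sup>2)\<close>, with \<open>b\<close> a fixed bump function, has compact support. The integral of
  \<open>w\<^sub>\<rho> Q J\<^sup>*\<close> (\<open>J\<^sup>*\<close> the complex conjugate of \<open>J\<close>) equals \<open>\<Prod>\<^sub>j \<rho>\<^sub>j\<^sup>2\<close> times a number independent of \<open>\<rho>\<close>: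
  changing one radius changes the normalized integrand by a \<open>\<partial>\<close>-bar-exact term, because the cofactors of
  the Jacobian matrix are divergence free.

  For \<open>\<rho>\<^sub>j\<close> proportional to \<open>t powr \<delta>\<^sub>j\<close> the weight is supported in the ball of radius \<open>t\<close>. There
  \<open>|Q| = O(t\<^sup>e)\<close>, and the integral of \<open>w\<^sub>\<rho> |J|\<^sup>2\<close> scales exactly (take \<open>Q = J\<close>), so Cauchy--Schwarz (below in its AM--GM form) bounds
  the constant by \<open>O(t powr (e + n - \<Sum>\<^sub>j \<delta>\<^sub>j))\<close>, which tends to 0. For \<open>\<rho>\<^sub>j = \<epsilon> \<rightarrow> 0\<close> the weight
  concentrates at the zeros of \<open>P\<close>, where \<open>Q J\<^sup>* = (Q / J) |J|\<^sup>2\<close>; if \<open>Q\<close> were nonzero at exactly one of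
  them, the constant would be nonzero.
\<close>

section \<open>Derivatives and growth of polynomials\<close>

lemma lookup_partial_deriv:
  "Poly_Mapping.lookup (partial_deriv k p) m =
     of_nat (Poly_Mapping.lookup m k + 1) * Poly_Mapping.lookup p (m + Poly_Mapping.single k 1)"
proof -
  let ?e = "Poly_Mapping.single k 1 :: 'a \<Rightarrow>\<^sub>0 nat"
  let ?t = "\<lambda>m'. of_nat (Poly_Mapping.lookup m' k) * Poly_Mapping.lookup p m'"
  \<comment> \<open>Exponent subtraction is truncated, so a monomial free of the k-th variable could
    also map to \<open>m\<close>; its coefficient carries the factor 0, which is why only
    \<open>m + ?e\<close> contributes.\<close>
  have shift: "m' = m + ?e" if "m' - ?e = m" "Poly_Mapping.lookup m' k \<noteq> 0" for m'
    using that by (auto intro!: poly_mapping_eqI simp: lookup_add lookup_minus lookup_single when_def)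
  have "Poly_Mapping.lookup (partial_deriv k p) m =
      (\<Sum>m'\<in>Poly_Mapping.keys p. if m' - ?e = m then ?t m' else 0)"
    by (simp add: partial_deriv_def lookup_sum lookup_single when_def)
  also have "\<dots> = (\<Sum>m'\<in>Poly_Mapping.keys p. if m' = m + ?e then ?t m' else 0)"
    using shift by (intro sum.cong refl) auto
  also have "\<dots> = ?t (m + ?e)"
    by (simp add: in_keys_iff)
  finally show ?thesis
    by (simp add: lookup_add lookup_single)
qed

lemma partial_deriv_commute:
  "partial_deriv k (partial_deriv l p) = partial_deriv l (partial_deriv k p)"
  by (rule poly_mapping_eqI)
     (simp add: lookup_partial_deriv lookup_add lookup_single when_def ac_simps)

lemma has_derivative_peval:
  "(peval p has_derivative (\<lambda>v. \<Sum>k\<in>UNIV. peval (partial_deriv k p) x * v $ k)) (at x)"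
proof -
  let ?r = "\<lambda>m k. \<Prod>v\<in>UNIV - {k}. (x $ v) ^ Poly_Mapping.lookup m v"
  have split: "(\<Prod>v\<in>UNIV. g v) = g k * (\<Prod>v\<in>UNIV - {k}. g v)" for g :: "'a \<Rightarrow> complex" and k
    by (simp add: prod.remove)
  have pd: "peval (partial_deriv k p) x =
      (\<Sum>m\<in>Poly_Mapping.keys p. Poly_Mapping.lookup p m *
         (of_nat (Poly_Mapping.lookup m k) * (x $ k) ^ (Poly_Mapping.lookup m k - 1) * ?r m k))" for k
    unfolding partial_deriv_def peval_sum_single[OF finite_keys] split[of _ k]
    by (intro sum.cong refl) (simp add: lookup_minus lookup_single when_def)
  have "(peval p has_derivative (\<lambda>v. \<Sum>m\<in>Poly_Mapping.keys p. Poly_Mapping.lookup p m *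
      (\<Sum>k\<in>UNIV. (of_nat (Poly_Mapping.lookup m k) * v $ k * (x $ k) ^ (Poly_Mapping.lookup m k - 1)) * ?r m k))) (at x)"
    unfolding peval_def[abs_def]
    by (intro has_derivative_sum has_derivative_mult_right has_derivative_prod has_derivative_power
        bounded_linear.has_derivative[OF bounded_linear_vec_nth] has_derivative_ident)
  also have "(\<lambda>v. \<Sum>m\<in>Poly_Mapping.keys p. Poly_Mapping.lookup p m *
      (\<Sum>k\<in>UNIV. (of_nat (Poly_Mapping.lookup m k) * v $ k * (x $ k) ^ (Poly_Mapping.lookup m k - 1)) * ?r m k))
     = (\<lambda>v. \<Sum>k\<in>UNIV. peval (partial_deriv k p) x * v $ k)"
    unfolding pd sum_distrib_left sum_distrib_right
    by (subst sum.swap) (simp add: ac_simps)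
  finally show ?thesis .
qed

lemma continuous_on_peval [continuous_intros]: "continuous_on S (peval p)"
  by (meson continuous_at_imp_continuous_on has_derivative_continuous has_derivative_peval)

text \<open>Every coordinate of (1, \<zeta>) is at most
  \<open>sqrt (1 + (norm \<zeta>)\<^sup>2)\<close> in modulus, and every monomial of
  \<open>q\<close> is a product of exactly \<open>e\<close> coordinates. This is how the degree of
  the hypersurface enters the estimates.\<close>

lemma norm_peval_dehomogenize_le:
  assumes "homogeneous e q"
  shows "cmod (peval (dehomogenize q) \<zeta>) \<le>
    (\<Sum>m\<in>Poly_Mapping.keys q. cmod (Poly_Mapping.lookup q m)) * sqrt (1 + (norm \<zeta>)\<^sup>2) ^ e"
proof -
  define X where "X = ((\<chi> v. case v of None \<Rightarrow> 1 | Some k \<Rightarrow> \<zeta> $ k) :: complex ^ 'a option)"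
  have X: "cmod (X $ v) \<le> sqrt (1 + (norm \<zeta>)\<^sup>2)" for v
  proof (cases v)
    case (Some k)
    have "cmod (\<zeta> $ k) \<le> norm \<zeta>"
      by (rule Finite_Cartesian_Product.norm_nth_le)
    also have "\<dots> \<le> sqrt (1 + (norm \<zeta>)\<^sup>2)"
      by (rule real_le_rsqrt) simp
    finally show ?thesis by (simp add: X_def Some)
  qed (simp add: X_def)
  have "cmod (peval q X) \<le> (\<Sum>m\<in>Poly_Mapping.keys q.
      cmod (Poly_Mapping.lookup q m) * (\<Prod>v\<in>UNIV. cmod (X $ v) ^ Poly_Mapping.lookup m v))"
    unfolding peval_def by (rule sum_norm_le) (simp add: norm_mult norm_power flip: prod_norm)
  also have "\<dots> \<le> (\<Sum>m\<in>Poly_Mapping.keys q.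
      cmod (Poly_Mapping.lookup q m) * sqrt (1 + (norm \<zeta>)\<^sup>2) ^ e)"
  proof (intro sum_mono mult_left_mono)
    fix m assume "m \<in> Poly_Mapping.keys q"
    then have "e = (\<Sum>v\<in>UNIV. Poly_Mapping.lookup m v)"
      using assms by (simp add: homogeneous_def monom_degree_def)
    then show "(\<Prod>v\<in>UNIV. cmod (X $ v) ^ Poly_Mapping.lookup m v) \<le> sqrt (1 + (norm \<zeta>)\<^sup>2) ^ e"
      by (auto simp: power_sum intro!: prod_mono power_mono X)
  qed simp
  finally show ?thesis
    by (simp add: peval_dehomogenize X_def sum_distrib_right)
qed

section \<open>Integrals of derivatives\<close>

lemma integral_translate_lborel:
  fixes f :: "'a::euclidean_space \<Rightarrow> 'b::{banach, second_countable_topology}"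
  assumes "f \<in> borel_measurable borel"
  shows "integral\<^sup>L lborel (\<lambda>x. f (a + x)) = integral\<^sup>L lborel f"
proof -
  have "integral\<^sup>L (distr lborel borel ((+) a)) f = integral\<^sup>L lborel (\<lambda>x. f (a + x))"
    by (rule integral_distr) (use assms in auto)
  then show ?thesis by (simp add: lborel_distr_plus)
qed

lemma integrable_continuous_bounded_support:
  fixes f :: "'a::euclidean_space \<Rightarrow> 'b::euclidean_space"
  assumes "continuous_on UNIV f" and "\<And>x. norm x > B \<Longrightarrow> f x = 0"
  shows "integrable lborel f"
proof -
  have "integrable lborel (\<lambda>x. indicator (cball 0 B) x *\<^sub>R f x)"
    by (rule borel_integrable_compact) (use assms(1) continuous_on_subset in auto)
  also have "(\<lambda>x. indicator (cball 0 B) x *\<^sub>R f x) = f"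
    using assms(2) by (auto simp: indicator_def fun_eq_iff not_le)
  finally show ?thesis .
qed

text \<open>Translation invariance makes the integral of each difference quotient in direction
  \<open>v\<close> vanish. The quotients converge to the derivative, and dominated convergence
  passes to the limit.\<close>

lemma integral_directional_derivative_eq_0:
  fixes f :: "'a::euclidean_space \<Rightarrow> 'b::euclidean_space"
  assumes der: "\<And>x. (f has_derivative f' x) (at x)"
    and cont: "continuous_on UNIV (\<lambda>x. f' x v)"
    and supp: "\<And>x. norm x > B \<Longrightarrow> f x = 0"
  shows "integrable lborel (\<lambda>x. f' x v)" and "integral\<^sup>L lborel (\<lambda>x. f' x v) = 0"
proof -
  have supp': "f' x v = 0" if "norm x > B" for x
  proof -
    have "open (- cball (0::'a) B)" "x \<in> - cball 0 B" using that by auto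
    then have "((\<lambda>_. 0) has_derivative f' x) (at x)"
      by (rule has_derivative_transform_within_open[OF der]) (auto intro: supp)
    then have "f' x = (\<lambda>_. 0)"
      by (rule has_derivative_unique) (rule has_derivative_const)
    then show ?thesis by simp
  qed
  show int: "integrable lborel (\<lambda>x. f' x v)"
    by (rule integrable_continuous_bounded_support[OF cont supp'])
  have "compact ((\<lambda>x. f' x v) ` cball 0 B)"
    using cont continuous_on_subset by (intro compact_continuous_image) auto
  then obtain K where K0: "K > 0" and K: "\<And>x. x \<in> cball 0 B \<Longrightarrow> norm (f' x v) \<le> K"
    by (auto dest!: compact_imp_bounded simp: bounded_pos)
  have K: "norm (f' x v) \<le> K" for x
    using K[of x] K0 supp'[of x] by (cases "norm x > B") auto
  have contf: "continuous_on UNIV f"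
    using der by (meson continuous_at_imp_continuous_on has_derivative_continuous)
  have fm: "f \<in> borel_measurable borel"
    using contf by (rule borel_measurable_continuous_onI)
  have fi: "integrable lborel f"
    by (rule integrable_continuous_bounded_support[OF contf supp])
  define h where "h n = inverse (real (Suc n))" for n
  have h: "h n > 0" "h n \<le> 1" for n
    by (auto simp: h_def field_simps)
  have h0: "h \<longlonglongrightarrow> 0"
    unfolding h_def by (rule LIMSEQ_inverse_real_of_nat)
  define g where "g n x = inverse (h n) *\<^sub>R (f (h n *\<^sub>R v + x) - f x)" for n x
  have line: "((\<lambda>s. f (s *\<^sub>R v + x)) has_derivative (\<lambda>s. s *\<^sub>R f' (s0 *\<^sub>R v + x) v)) (at s0 within S)"
    for x s0 S
  proof -
    have "((\<lambda>s. f (s *\<^sub>R v + x)) has_derivative (\<lambda>s. f' (s0 *\<^sub>R v + x) (s *\<^sub>R v))) (at s0 within S)"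
      by (rule has_derivative_compose[OF _ der]) (auto intro!: derivative_eq_intros)
    moreover have "f' y (s *\<^sub>R v) = s *\<^sub>R f' y v" for y s
      using der[of y] by (simp add: has_derivative_bounded_linear linear_scale bounded_linear.linear)
    ultimately show ?thesis by simp
  qed
  \<comment> \<open>The mean value inequality gives the constant \<open>K\<close>. Since the step
    \<open>h n\<close> is at most 1, all quotients are supported in the ball enlarged by
    \<open>norm v\<close>.\<close>
  have bound: "norm (g n x) \<le> K * indicator (cball 0 (B + norm v)) x" for n x
  proof (cases "x \<in> cball 0 (B + norm v)")
    case True
    have "norm (f (h n *\<^sub>R v + x) - f (0 *\<^sub>R v + x)) \<le> K * norm (h n - 0)"
    proof (rule differentiable_bound[where S = UNIV])
      fix s :: real
      have "onorm (\<lambda>s. s *\<^sub>R f' (t *\<^sub>R v + x) v) = norm (f' (t *\<^sub>R v + x) v)" for t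
        using onorm_scaleR_left[of "\<lambda>x::real. x"] by (simp add: onorm_id)
      then show "onorm (\<lambda>t. t *\<^sub>R f' (s *\<^sub>R v + x) v) \<le> K" using K by simp
    qed (auto intro: line)
    then show ?thesis using True h[of n] by (simp add: g_def divide_simps ac_simps)
  next
    case False
    then have x: "norm x > B + norm v" by simp
    have "norm x \<le> norm (h n *\<^sub>R v + x) + norm (h n *\<^sub>R v)"
      using norm_triangle_ineq4[of "h n *\<^sub>R v + x" "h n *\<^sub>R v"] by simp
    moreover have "norm (h n *\<^sub>R v) \<le> norm v"
      using h[of n] by (simp add: mult_left_le_one_le)
    ultimately have "norm (h n *\<^sub>R v + x) > B" using x by linarith
    moreover have "norm x > B" using x norm_ge_zero[of v] by linarith
    ultimately show ?thesis using False by (simp add: g_def supp)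
  qed
  have lim: "(\<lambda>n. g n x) \<longlonglongrightarrow> f' x v" for x
  proof -
    have "((\<lambda>s. norm (f (s *\<^sub>R v + x) - f x - s *\<^sub>R f' x v) / norm s) \<longlongrightarrow> 0) (at 0)"
      using line[of x 0 UNIV] by (simp add: has_derivative_at)
    moreover have "norm (inverse s *\<^sub>R (f (s *\<^sub>R v + x) - f x) - f' x v) =
        norm (f (s *\<^sub>R v + x) - f x - s *\<^sub>R f' x v) / norm s" if "s \<noteq> 0" for s
    proof -
      have "f (s *\<^sub>R v + x) - f x - s *\<^sub>R f' x v = s *\<^sub>R (inverse s *\<^sub>R (f (s *\<^sub>R v + x) - f x) - f' x v)"
        using that by (simp add: scaleR_diff_right)
      then show ?thesis using that by simp
    qed
    ultimately have "((\<lambda>s. norm (inverse s *\<^sub>R (f (s *\<^sub>R v + x) - f x) - f' x v)) \<longlongrightarrow> 0) (at 0)"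
      by (elim Lim_transform_eventually) (simp add: eventually_at_filter)
    then have "((\<lambda>s. inverse s *\<^sub>R (f (s *\<^sub>R v + x) - f x)) \<longlongrightarrow> f' x v) (at 0)"
      by (rule Lim_null[THEN iffD2, OF tendsto_norm_zero_cancel])
    moreover have "filterlim h (at 0) sequentially"
      using h0 h(1) by (auto simp: filterlim_at less_imp_neq[symmetric])
    ultimately show ?thesis
      unfolding g_def by (rule filterlim_compose)
  qed
  have "(\<lambda>n. integral\<^sup>L lborel (g n)) \<longlonglongrightarrow> integral\<^sup>L lborel (\<lambda>x. f' x v)"
  proof (rule integral_dominated_convergence[where w = "\<lambda>x. K * indicator (cball 0 (B + norm v)) x"])
    show "integrable lborel (\<lambda>x. K * indicator (cball (0::'a) (B + norm v)) x)"
      using emeasure_bounded_finite[OF bounded_cball, of "0::'a" "B + norm v"]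
      by (intro integrable_mult_right integrable_real_indicator) auto
    show "g n \<in> borel_measurable lborel" for n
      unfolding g_def using fm by measurable
  qed (use int lim bound in auto)
  moreover have "integral\<^sup>L lborel (g n) = 0" for n
  proof -
    have int': "integrable lborel (\<lambda>x. f (h n *\<^sub>R v + x))"
      using fi integrable_distr_eq[of "(+) (h n *\<^sub>R v)" lborel borel f] fm
      by (simp add: lborel_distr_plus)
    have "integral\<^sup>L lborel (g n) =
        inverse (h n) *\<^sub>R integral\<^sup>L lborel (\<lambda>x. f (h n *\<^sub>R v + x) - f x)"
      unfolding g_def[abs_def] by (rule integral_scaleR_right)
    also have "integral\<^sup>L lborel (\<lambda>x. f (h n *\<^sub>R v + x) - f x) = 0"
      using fi int' by (simp add: integral_translate_lborel[OF fm])
    finally show ?thesis by simp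
  qed
  ultimately show "integral\<^sup>L lborel (\<lambda>x. f' x v) = 0"
    by (simp add: LIMSEQ_const_iff)
qed

section \<open>The operator \<open>\<partial>\<close>-bar\<close>

text \<open>The derivative \<open>f'\<close> is only real linear; \<open>axis k 1\<close> and
  \<open>axis k \<i>\<close> are the two real directions of the k-th coordinate, so
  \<open>D k\<close> is the Wirtinger derivative in the conjugate of that coordinate. With
  \<open>D = 0\<close> this says that \<open>f\<close> is holomorphic.\<close>

definition has_dbar :: "(complex ^ 'n \<Rightarrow> complex) \<Rightarrow> ('n::finite \<Rightarrow> complex ^ 'n \<Rightarrow> complex) \<Rightarrow> bool" where
  "has_dbar f D \<longleftrightarrow> (\<exists>f'. (\<forall>x. (f has_derivative f' x) (at x)) \<and>
     (\<forall>v. continuous_on UNIV (\<lambda>x. f' x v)) \<and>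
     (\<forall>k x. D k x = (f' x (axis k 1) + \<i> * f' x (axis k \<i>)) / 2))"

lemma has_dbar_cong:
  assumes "has_dbar f D" and "\<And>k x. D k x = D' k x"
  shows "has_dbar f D'"
proof -
  have "D = D'" using assms(2) by (intro ext)
  then show ?thesis using assms(1) by simp
qed

lemma has_dbar_const: "has_dbar (\<lambda>_. c) (\<lambda>_ _. 0)"
  unfolding has_dbar_def by (intro exI[of _ "\<lambda>_ _. 0"]) auto

lemma has_dbar_peval: "has_dbar (peval p) (\<lambda>_ _. 0)"
  unfolding has_dbar_def
  by (intro exI[of _ "\<lambda>x v. \<Sum>k\<in>UNIV. peval (partial_deriv k p) x * v $ k"] conjI allI
      has_derivative_peval continuous_intros)
     (simp add: axis_def if_distrib[where f = "\<lambda>z. _ * z"] mult.commute[of _ \<i>] cong: if_cong)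

lemma has_dbar_cnj_peval:
  "has_dbar (\<lambda>x. cnj (peval p x)) (\<lambda>k x. cnj (peval (partial_deriv k p) x))"
  unfolding has_dbar_def
  by (intro exI[of _ "\<lambda>x v. cnj (\<Sum>k\<in>UNIV. peval (partial_deriv k p) x * v $ k)"] conjI allI
      bounded_linear.has_derivative[OF bounded_linear_cnj] has_derivative_peval continuous_intros)
     (simp add: axis_def if_distrib[where f = "\<lambda>z. _ * z"] if_distrib[where f = cnj]
        mult.commute[of _ \<i>] cong: if_cong)

lemma has_dbar_imp_continuous_on:
  assumes "has_dbar f D"
  shows "continuous_on UNIV f"
  using assms unfolding has_dbar_def
  by (meson continuous_at_imp_continuous_on has_derivative_continuous)

lemma has_dbar_mult:
  assumes "has_dbar f D" and "has_dbar g E"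
  shows "has_dbar (\<lambda>x. f x * g x) (\<lambda>k x. D k x * g x + f x * E k x)"
proof -
  obtain f' where f': "\<And>x. (f has_derivative f' x) (at x)" "\<And>v. continuous_on UNIV (\<lambda>x. f' x v)"
      "\<And>k x. D k x = (f' x (axis k 1) + \<i> * f' x (axis k \<i>)) / 2"
    using assms(1) unfolding has_dbar_def by blast
  obtain g' where g': "\<And>x. (g has_derivative g' x) (at x)" "\<And>v. continuous_on UNIV (\<lambda>x. g' x v)"
      "\<And>k x. E k x = (g' x (axis k 1) + \<i> * g' x (axis k \<i>)) / 2"
    using assms(2) unfolding has_dbar_def by blast
  show ?thesis
    unfolding has_dbar_def
    by (intro exI[of _ "\<lambda>x v. f x * g' x v + f' x v * g x"] conjI allI
        has_derivative_mult f' g' continuous_intros assms[THEN has_dbar_imp_continuous_on])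
       (simp add: f'(3) g'(3) field_simps)
qed

lemma has_dbar_add:
  assumes "has_dbar f D" and "has_dbar g E"
  shows "has_dbar (\<lambda>x. f x + g x) (\<lambda>k x. D k x + E k x)"
proof -
  obtain f' where f': "\<And>x. (f has_derivative f' x) (at x)" "\<And>v. continuous_on UNIV (\<lambda>x. f' x v)"
      "\<And>k x. D k x = (f' x (axis k 1) + \<i> * f' x (axis k \<i>)) / 2"
    using assms(1) unfolding has_dbar_def by blast
  obtain g' where g': "\<And>x. (g has_derivative g' x) (at x)" "\<And>v. continuous_on UNIV (\<lambda>x. g' x v)"
      "\<And>k x. E k x = (g' x (axis k 1) + \<i> * g' x (axis k \<i>)) / 2"
    using assms(2) unfolding has_dbar_def by blast
  show ?thesis
    unfolding has_dbar_def
    by (intro exI[of _ "\<lambda>x v. f' x v + g' x v"] conjI allI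
        has_derivative_add f' g' continuous_intros)
       (simp add: f'(3) g'(3) field_simps)
qed

lemma has_dbar_sum:
  assumes "finite A" and "\<And>a. a \<in> A \<Longrightarrow> has_dbar (f a) (D a)"
  shows "has_dbar (\<lambda>x. \<Sum>a\<in>A. f a x) (\<lambda>k x. \<Sum>a\<in>A. D a k x)"
  using assms by (induction A rule: finite_induct) (auto intro: has_dbar_const has_dbar_add)

lemma has_dbar_prod:
  assumes "finite A" and "\<And>a. a \<in> A \<Longrightarrow> has_dbar (f a) (D a)"
  shows "has_dbar (\<lambda>x. \<Prod>a\<in>A. f a x) (\<lambda>k x. \<Sum>l\<in>A. D l k x * (\<Prod>a\<in>A - {l}. f a x))"
  using assms
proof (induction A rule: finite_induct)
  case empty
  then show ?case by (simp add: has_dbar_const)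
next
  case (insert b A)
  have "has_dbar (\<lambda>x. f b x * (\<Prod>a\<in>A. f a x)) (\<lambda>k x. D b k x * (\<Prod>a\<in>A. f a x) +
      f b x * (\<Sum>l\<in>A. D l k x * (\<Prod>a\<in>A - {l}. f a x)))"
    by (rule has_dbar_mult) (use insert in auto)
  then show ?case
  proof (rule has_dbar_cong[of "\<lambda>x. f b x * (\<Prod>a\<in>A. f a x)", THEN back_subst[of "\<lambda>f. has_dbar f _"]])
    show "(\<lambda>x. f b x * (\<Prod>a\<in>A. f a x)) = (\<lambda>x. \<Prod>a\<in>insert b A. f a x)"
      using insert by simp
    fix k x
    have "f b x * (D l k x * (\<Prod>a\<in>A - {l}. f a x)) = D l k x * (\<Prod>a\<in>insert b A - {l}. f a x)"
      if "l \<in> A" for l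
    proof -
      have "insert b A - {l} = insert b (A - {l})" using that insert by auto
      then show ?thesis using insert by simp
    qed
    then have "f b x * (\<Sum>l\<in>A. D l k x * (\<Prod>a\<in>A - {l}. f a x)) =
        (\<Sum>l\<in>A. D l k x * (\<Prod>a\<in>insert b A - {l}. f a x))"
      unfolding sum_distrib_left by (rule sum.cong[OF refl])
    moreover have "insert b A - {b} = A" using insert by auto
    ultimately show "D b k x * (\<Prod>a\<in>A. f a x) + f b x * (\<Sum>l\<in>A. D l k x * (\<Prod>a\<in>A - {l}. f a x)) =
        (\<Sum>l\<in>insert b A. D l k x * (\<Prod>a\<in>insert b A - {l}. f a x))"
      using insert by simp
  qed
qed

text \<open>Chain rule: |p|^2 is \<open>p\<close> times its conjugate and \<open>p\<close> is
  holomorphic, so the operator acts on the conjugate factor alone.\<close>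

lemma has_dbar_radial:
  assumes G: "\<And>s. (G has_real_derivative G' s) (at s)" and G': "continuous_on UNIV G'"
  shows "has_dbar (\<lambda>x. of_real (G ((cmod (peval p x))\<^sup>2)))
    (\<lambda>k x. of_real (G' ((cmod (peval p x))\<^sup>2)) * peval p x * cnj (peval (partial_deriv k p) x))"
proof -
  let ?d = "\<lambda>x v. \<Sum>k\<in>UNIV. peval (partial_deriv k p) x * v $ k"
  let ?s = "\<lambda>x. (cmod (peval p x))\<^sup>2"
  have d: "?d x (axis k c) = c * peval (partial_deriv k p) x" for x k c
    by (simp add: axis_def if_distrib[where f = "\<lambda>z. _ * z"] cong: if_cong)
  have s: "(?s has_derivative (\<lambda>v. 2 * (peval p x \<bullet> ?d x v))) (at x)" for x
    unfolding dot_square_norm[symmetric]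
    by (rule has_derivative_eq_rhs[OF has_derivative_inner[OF has_derivative_peval has_derivative_peval]])
       (simp add: inner_commute)
  have "((\<lambda>x. G (?s x)) has_derivative (\<lambda>v. G' (?s x) * (2 * (peval p x \<bullet> ?d x v)))) (at x)" for x
    using has_derivative_compose[OF s G[unfolded has_field_derivative_def]] by simp
  then have "((\<lambda>x. complex_of_real (G (?s x))) has_derivative
      (\<lambda>v. of_real (G' (?s x) * (2 * (peval p x \<bullet> ?d x v))))) (at x)" for x
    by (rule has_derivative_of_real)
  moreover have "continuous_on UNIV (\<lambda>x. complex_of_real (G' (?s x) * (2 * (peval p x \<bullet> ?d x v))))" for v
    by (intro continuous_intros continuous_on_compose2[OF G']) auto
  moreover have "of_real (G' (?s x)) * peval p x * cnj (peval (partial_deriv k p) x) =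
      (of_real (G' (?s x) * (2 * (peval p x \<bullet> ?d x (axis k 1)))) +
       \<i> * of_real (G' (?s x) * (2 * (peval p x \<bullet> ?d x (axis k \<i>))))) / 2" for k x
    unfolding d by (simp add: complex_eq_iff inner_complex_def algebra_simps)
  ultimately show ?thesis
    unfolding has_dbar_def
    by (intro exI[of _ "\<lambda>x v. complex_of_real (G' (?s x) * (2 * (peval p x \<bullet> ?d x v)))"]) blast
qed

lemma integral_dbar_eq_0:
  assumes "has_dbar f D" and supp: "\<And>x. norm x > B \<Longrightarrow> f x = 0"
  shows "integrable lborel (D k)" and "integral\<^sup>L lborel (D k) = 0"
proof -
  obtain f' where f': "\<And>x. (f has_derivative f' x) (at x)" "\<And>v. continuous_on UNIV (\<lambda>x. f' x v)"
      "\<And>k x. D k x = (f' x (axis k 1) + \<i> * f' x (axis k \<i>)) / 2"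
    using assms(1) unfolding has_dbar_def by blast
  note int = integral_directional_derivative_eq_0[OF f'(1) f'(2) supp]
  have D: "D k = (\<lambda>x. (f' x (axis k 1) + \<i> * f' x (axis k \<i>)) / 2)"
    by (rule ext) (rule f'(3))
  show "integrable lborel (D k)" "integral\<^sup>L lborel (D k) = 0"
    unfolding D using int by simp_all
qed

section \<open>Cofactor identities\<close>

text \<open>The left side is the Leibniz expansion of the determinant of \<open>A\<close> with row
  \<open>i\<close> replaced by the combination of all rows with coefficients \<open>F l\<close>. A
  term with \<open>l \<noteq> i\<close> repeats a row and vanishes.\<close>

lemma sum_permutations_row_combination:
  fixes A :: "'a::comm_ring_1 ^ 'n ^ 'n::finite"
  shows "(\<Sum>p | p permutes UNIV. of_int (sign p) *
      ((\<Sum>l\<in>UNIV. F l * A $ l $ p i) * (\<Prod>j\<in>UNIV - {i}. A $ j $ p j))) = F i * det A"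
proof -
  have expand: "det (\<chi> j. if j = i then a else A $ j) =
      (\<Sum>p | p permutes UNIV. of_int (sign p) * (a $ p i * (\<Prod>j\<in>UNIV - {i}. A $ j $ p j)))" for a
    unfolding det_def by (intro sum.cong refl arg_cong2[where f = "(*)"]) (simp add: prod.remove[where x = i])
  have "(\<Sum>p | p permutes UNIV. of_int (sign p) *
      ((\<Sum>l\<in>UNIV. F l * A $ l $ p i) * (\<Prod>j\<in>UNIV - {i}. A $ j $ p j))) =
      det (\<chi> j. if j = i then (\<Sum>l\<in>UNIV. F l *s A $ l) else A $ j)"
    unfolding expand by simp
  also have "\<dots> = (\<Sum>l\<in>UNIV. F l * det (\<chi> j. if j = i then A $ l else A $ j))"
    unfolding det_linear_row_sum[OF finite, where k = i and a = "\<lambda>_ l. F l *s A $ l" and c = "\<lambda>j. A $ j"]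
    by (intro sum.cong refl det_row_mul)
  also have "\<dots> = (\<Sum>l\<in>UNIV. if l = i then F i * det A else 0)"
  proof (intro sum.cong refl)
    fix l
    show "F l * det (\<chi> j. if j = i then A $ l else A $ j) = (if l = i then F i * det A else 0)"
    proof (cases "l = i")
      case True
      then have "(\<chi> j. if j = i then A $ l else A $ j) = A" by (simp add: vec_eq_iff)
      then show ?thesis using True by simp
    next
      case False
      then have "det (\<chi> j. if j = i then A $ l else A $ j) = 0"
        by (intro det_identical_rows[of i l]) (auto simp: row_def vec_eq_iff)
      then show ?thesis using False by simp
    qed
  qed
  finally show ?thesis by simp
qed

text \<open>For fixed \<open>l\<close>, composing the permutation with the transposition of
  \<open>i\<close> and \<open>l\<close> flips the sign and, by the symmetry of \<open>S\<close>,
  nothing else, so the terms cancel in pairs. With second derivatives as \<open>S\<close>, this says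
  that the cofactors are divergence free.\<close>

lemma sum_permutations_symmetric_eq_0:
  fixes a :: "'n::finite \<Rightarrow> 'n \<Rightarrow> 'a::field_char_0"
  assumes sym: "\<And>l k m. S l k m = S l m k"
  shows "(\<Sum>p | p permutes UNIV. of_int (sign p) *
      (\<Sum>l\<in>UNIV - {i}. S l (p i) (p l) * (\<Prod>j\<in>UNIV - {i} - {l}. a j (p j)))) = 0"
proof -
  let ?t = "\<lambda>l p. of_int (sign p) * (S l (p i) (p l) * (\<Prod>j\<in>UNIV - {i} - {l}. a j (p j)))"
  have "(\<Sum>p | p permutes UNIV. ?t l p) = 0" if "l \<noteq> i" for l
  proof -
    let ?\<tau> = "Transposition.transpose i l"
    have \<tau>: "?\<tau> permutes UNIV" by (rule permutes_swap_id) auto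
    have "(\<Sum>p | p permutes UNIV. ?t l p) = (\<Sum>p | p permutes UNIV. ?t l (p \<circ> ?\<tau>))"
      by (rule sum_permutations_compose_right[OF \<tau>])
    also have "\<dots> = (\<Sum>p | p permutes UNIV. - ?t l p)"
    proof (intro sum.cong refl)
      fix p :: "'n \<Rightarrow> 'n" assume "p \<in> {p. p permutes UNIV}"
      then have "sign (p \<circ> ?\<tau>) = - sign p"
        using that \<tau> by (simp add: sign_compose permutes_imp_permutation[of UNIV] sign_swap_id)
      moreover have "(\<Prod>j\<in>UNIV - {i} - {l}. a j ((p \<circ> ?\<tau>) j)) = (\<Prod>j\<in>UNIV - {i} - {l}. a j (p j))"
        by (intro prod.cong refl) (auto simp: Transposition.transpose_def)
      moreover have "S l ((p \<circ> ?\<tau>) i) ((p \<circ> ?\<tau>) l) = S l (p i) (p l)"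
        using sym[of l "p i" "p l"] by simp
      ultimately show "?t l (p \<circ> ?\<tau>) = - ?t l p"
        by (simp only: of_int_minus mult_minus_left)
    qed
    finally show ?thesis by (simp add: sum_negf)
  qed
  then have "(\<Sum>l\<in>UNIV - {i}. \<Sum>p | p permutes UNIV. ?t l p) = 0"
    by (intro sum.neutral) auto
  then show ?thesis
    by (subst (asm) sum.swap) (simp add: sum_distrib_left)
qed

section \<open>Exact integrands\<close>

lemma has_dbar_det_jacobian: "has_dbar (\<lambda>x. det (jacobian_matrix P x)) (\<lambda>_ _. 0)"
proof -
  have "has_dbar (\<lambda>x. \<Sum>p | p permutes UNIV. of_int (sign p) *
      (\<Prod>j\<in>UNIV. peval (partial_deriv (p j) (P j)) x)) (\<lambda>k x. \<Sum>p | p permutes UNIV. 0 *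
      (\<Prod>j\<in>UNIV. peval (partial_deriv (p j) (P j)) x) + of_int (sign p) *
      (\<Sum>l\<in>UNIV. 0 * (\<Prod>j\<in>UNIV - {l}. peval (partial_deriv (p j) (P j)) x)))"
    by (intro has_dbar_sum has_dbar_mult has_dbar_prod has_dbar_const has_dbar_peval) auto
  then show ?thesis
    by (simp add: det_def jacobian_matrix_def)
qed

lemma cnj_det: "cnj (det A) = det (\<chi> i j. cnj (A $ i $ j))"
  by (simp add: det_def)

text \<open>Properness of P gives every weight a compact support. Squared moduli are used because
  the weights are functions of them.\<close>

locale proper_system =
  fixes P :: "'n::finite \<Rightarrow> 'n cpoly"
  assumes proper: "\<exists>B. \<forall>x. (\<forall>j. (cmod (peval (P j) x))\<^sup>2 \<le> M) \<longrightarrow> norm x \<le> B"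
begin

abbreviation sq :: "'n \<Rightarrow> complex ^ 'n \<Rightarrow> real" where
  "sq j x \<equiv> (cmod (peval (P j) x))\<^sup>2"

abbreviation jac :: "complex ^ 'n \<Rightarrow> complex" where
  "jac x \<equiv> det (jacobian_matrix P x)"

text \<open>\<open>F l\<close> stands for the derivative of \<open>f\<close> in the conjugate of \<open>P\<^sub>l\<close>.\<close>

abbreviation has_dbar_along :: "(complex ^ 'n \<Rightarrow> complex) \<Rightarrow> ('n \<Rightarrow> complex ^ 'n \<Rightarrow> complex) \<Rightarrow> bool" where
  "has_dbar_along f F \<equiv> has_dbar f (\<lambda>k x. \<Sum>l\<in>UNIV. F l x * cnj (peval (partial_deriv k (P l)) x))"

text \<open>Only the conjugates of the \<open>P l\<close> with \<open>l\<close> in \<open>A\<close>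
  are differentiated. The vanishing for other \<open>l\<close> is needed with
  \<open>A = UNIV - {i}\<close>, where the product must not contribute to the component
  \<open>i\<close>.\<close>

lemma has_dbar_along_radial_prod:
  assumes "finite A"
    and h: "\<And>j s. j \<in> A \<Longrightarrow> (h j has_real_derivative h' j s) (at s)"
    and h': "\<And>j. j \<in> A \<Longrightarrow> continuous_on UNIV (h' j)"
  shows "\<exists>F. has_dbar_along (\<lambda>x. \<Prod>j\<in>A. of_real (h j (sq j x))) F \<and> (\<forall>l x. l \<notin> A \<longrightarrow> F l x = 0)"
proof -
  let ?D = "\<lambda>l k x. of_real (h' l (sq l x)) * peval (P l) x * cnj (peval (partial_deriv k (P l)) x)"
  let ?R = "\<lambda>l x. \<Prod>j\<in>A - {l}. complex_of_real (h j (sq j x))"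
  let ?F = "\<lambda>l x. if l \<in> A then of_real (h' l (sq l x)) * peval (P l) x * ?R l x else 0"
  have "has_dbar (\<lambda>x. \<Prod>j\<in>A. of_real (h j (sq j x))) (\<lambda>k x. \<Sum>l\<in>A. ?D l k x * ?R l x)"
    using assms by (intro has_dbar_prod has_dbar_radial) auto
  then have "has_dbar_along (\<lambda>x. \<Prod>j\<in>A. of_real (h j (sq j x))) ?F"
  proof (rule has_dbar_cong)
    fix k x
    show "(\<Sum>l\<in>A. ?D l k x * ?R l x) = (\<Sum>l\<in>UNIV. ?F l x * cnj (peval (partial_deriv k (P l)) x))"
      by (rule sum.mono_neutral_cong_left) auto
  qed
  then show ?thesis by (intro exI[of _ ?F]) auto
qed

text \<open>The integrand is the divergence, in the conjugate variables, of f Q times row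
  \<open>i\<close> of the cofactors of the conjugate Jacobian matrix, where f is the conjugate of
  P_i times G(|P_i|^2) and the remaining factors \<open>h j\<close>. Differentiating f in the
  conjugate of P_i turns G into G + s G' at s = |P_i|^2.\<close>

lemma integral_exact_radial_eq_0:
  assumes G: "\<And>s. (G has_real_derivative G' s) (at s)" "continuous_on UNIV G'"
    and h: "\<And>j s. (h j has_real_derivative h' j s) (at s)" "\<And>j. continuous_on UNIV (h' j)"
    and supp: "\<And>s. s > M \<Longrightarrow> G s = 0" "\<And>j s. s > M \<Longrightarrow> h j s = 0"
    and Q: "has_dbar Q (\<lambda>_ _. 0)"
  shows "integral\<^sup>L lborel (\<lambda>x. of_real ((G (sq i x) + sq i x * G' (sq i x)) *
           (\<Prod>j\<in>UNIV - {i}. h j (sq j x))) * Q x * cnj (jac x)) = 0"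
proof -
  let ?d = "\<lambda>j k x. cnj (peval (partial_deriv k (P j)) x)"
  let ?H = "\<lambda>x. \<Prod>j\<in>UNIV - {i}. complex_of_real (h j (sq j x))"
  define f where "f x = cnj (peval (P i) x) * of_real (G (sq i x)) * ?H x" for x
  let ?g = "\<lambda>x. complex_of_real (G (sq i x) + sq i x * G' (sq i x))"
  obtain H' where H': "has_dbar_along ?H H'" and H'i: "\<And>x. H' i x = 0"
    using has_dbar_along_radial_prod[of "UNIV - {i}" h h'] h by auto
  define F where "F l x = (if l = i then ?g x else 0) * ?H x +
      cnj (peval (P i) x) * of_real (G (sq i x)) * H' l x" for l x
  have "has_dbar f (\<lambda>k x. (?d i k x * of_real (G (sq i x)) +
      cnj (peval (P i) x) * (of_real (G' (sq i x)) * peval (P i) x * ?d i k x)) * ?H x +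
      cnj (peval (P i) x) * of_real (G (sq i x)) * (\<Sum>l\<in>UNIV. H' l x * ?d l k x))"
    unfolding f_def by (intro has_dbar_mult has_dbar_cnj_peval has_dbar_radial G H')
  then have f: "has_dbar_along f F"
  proof (rule has_dbar_cong)
    fix k x
    have "(\<Sum>l\<in>UNIV. F l x * ?d l k x) = (\<Sum>l\<in>UNIV. (if l = i then ?g x * ?H x * ?d i k x else 0)) +
        cnj (peval (P i) x) * of_real (G (sq i x)) * (\<Sum>l\<in>UNIV. H' l x * ?d l k x)"
      unfolding sum_distrib_left sum.distrib[symmetric] F_def
      by (intro sum.cong refl) (auto simp: algebra_simps)
    also have "\<dots> = ?g x * ?H x * ?d i k x +
        cnj (peval (P i) x) * of_real (G (sq i x)) * (\<Sum>l\<in>UNIV. H' l x * ?d l k x)"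
      by simp
    also have "?g x = of_real (G (sq i x)) + of_real (G' (sq i x)) * (cnj (peval (P i) x) * peval (P i) x)"
      by (simp add: complex_norm_square mult.commute del: of_real_power)
    finally show "(?d i k x * of_real (G (sq i x)) +
      cnj (peval (P i) x) * (of_real (G' (sq i x)) * peval (P i) x * ?d i k x)) * ?H x +
      cnj (peval (P i) x) * of_real (G (sq i x)) * (\<Sum>l\<in>UNIV. H' l x * ?d l k x) =
      (\<Sum>l\<in>UNIV. F l x * ?d l k x)"
      by (simp add: algebra_simps)
  qed
  obtain B where B: "\<And>x. (\<forall>j. sq j x \<le> M) \<Longrightarrow> norm x \<le> B"
    using proper[of M] by blast
  have f0: "f x = 0" if "norm x > B" for x
  proof -
    from that B[of x] obtain j where "sq j x > M" by (meson not_le)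
    then show ?thesis
      by (cases "j = i") (auto simp: f_def supp intro!: prod_zero bexI[of _ j])
  qed
  \<comment> \<open>Cofactors are kept expanded over permutations: the signed sum of
    \<open>?c p\<close> over all \<open>p\<close> with \<open>p i = k\<close> is the cofactor at
    position (i, k). \<open>?c'\<close> is the derivative of \<open>?c\<close> in the k-th conjugate
    variable.\<close>
  let ?c = "\<lambda>p x. \<Prod>j\<in>UNIV - {i}. ?d j (p j) x"
  let ?c' = "\<lambda>p k x. \<Sum>l\<in>UNIV - {i}. cnj (peval (partial_deriv k (partial_deriv (p l) (P l))) x) *
      (\<Prod>j\<in>UNIV - {i} - {l}. ?d j (p j) x)"
  define D where "D p k x = ((\<Sum>l\<in>UNIV. F l x * ?d l k x) * ?c p x + f x * ?c' p k x) * Q x +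
      (f x * ?c p x) * 0" for p k x
  have D: "has_dbar (\<lambda>x. f x * ?c p x * Q x) (D p)" for p
    unfolding D_def[abs_def]
    by (intro has_dbar_mult f has_dbar_prod has_dbar_cnj_peval Q) auto
  have int: "integrable lborel (D p k)" "integral\<^sup>L lborel (D p k) = 0" for p k
    using integral_dbar_eq_0[OF D, of B p k] f0 by auto
  \<comment> \<open>For the permutation \<open>p\<close> only the direction \<open>k = p i\<close>
    is taken; the signed sum over \<open>p\<close> is then the divergence of the cofactor
    field.\<close>
  have "0 = (\<Sum>p | p permutes UNIV. of_int (sign p) * integral\<^sup>L lborel (D p (p i)))"
    by (simp add: int)
  also have "\<dots> = integral\<^sup>L lborel (\<lambda>x. \<Sum>p | p permutes UNIV. of_int (sign p) * D p (p i) x)"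
    by (subst Bochner_Integration.integral_sum) (auto intro: int)
  also have "(\<lambda>x. \<Sum>p | p permutes UNIV. of_int (sign p) * D p (p i) x) =
      (\<lambda>x. of_real ((G (sq i x) + sq i x * G' (sq i x)) *
           (\<Prod>j\<in>UNIV - {i}. h j (sq j x))) * Q x * cnj (jac x))"
  proof
    fix x
    define A where "A = (\<chi> j k. ?d j k x)"
    have A: "det A = cnj (jac x)"
      by (simp add: cnj_det A_def jacobian_matrix_def)
    \<comment> \<open>The first sum differentiates \<open>f\<close> and collapses to
      \<open>F i x * det A\<close>; the second differentiates the cofactors and cancels because
      mixed partial derivatives commute.\<close>
    have "(\<Sum>p | p permutes UNIV. of_int (sign p) * D p (p i) x) =
        (\<Sum>p | p permutes UNIV. of_int (sign p) * ((\<Sum>l\<in>UNIV. F l x * A $ l $ p i) *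
            (\<Prod>j\<in>UNIV - {i}. A $ j $ p j))) * Q x +
        (\<Sum>p | p permutes UNIV. of_int (sign p) * ?c' p (p i) x) * (f x * Q x)"
      unfolding sum_distrib_right sum.distrib[symmetric] D_def A_def
      by (intro sum.cong refl) (simp add: algebra_simps)
    also have "(\<Sum>p | p permutes UNIV. of_int (sign p) * ?c' p (p i) x) = 0"
      by (rule sum_permutations_symmetric_eq_0[where
            S = "\<lambda>l k m. cnj (peval (partial_deriv k (partial_deriv m (P l))) x)"])
         (simp add: partial_deriv_commute)
    also have "(\<Sum>p | p permutes UNIV. of_int (sign p) * ((\<Sum>l\<in>UNIV. F l x * A $ l $ p i) *
            (\<Prod>j\<in>UNIV - {i}. A $ j $ p j))) = F i x * det A"
      by (rule sum_permutations_row_combination)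
    finally show "(\<Sum>p | p permutes UNIV. of_int (sign p) * D p (p i) x) =
        of_real ((G (sq i x) + sq i x * G' (sq i x)) *
           (\<Prod>j\<in>UNIV - {i}. h j (sq j x))) * Q x * cnj (jac x)"
      by (simp add: A F_def H'i)
  qed
  finally show ?thesis by simp
qed

end

section \<open>Weighted integrals\<close>

lemma has_real_derivative_glue:
  fixes f g f' g' :: "real \<Rightarrow> real"
  assumes f: "\<And>s. s \<le> a \<Longrightarrow> (f has_real_derivative f' s) (at s)"
    and g: "\<And>s. a \<le> s \<Longrightarrow> (g has_real_derivative g' s) (at s)"
    and eq: "f a = g a" "f' a = g' a"
  shows "((\<lambda>s. if s \<le> a then f s else g s) has_real_derivative (if s \<le> a then f' s else g' s)) (at s)"
proof -
  let ?h = "\<lambda>s. if s \<le> a then f s else g s"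
  consider "s < a" | "s > a" | "s = a" by linarith
  then show ?thesis
  proof cases
    case 1
    then have "(?h has_real_derivative f' s) (at s)"
      by (intro has_field_derivative_transform_within_open[OF f, of s "{..<a}"]) auto
    with 1 show ?thesis by simp
  next
    case 2
    then have "(?h has_real_derivative g' s) (at s)"
      by (intro has_field_derivative_transform_within_open[OF g, of s "{a<..}"]) auto
    with 2 show ?thesis by simp
  next
    case 3
    have "(?h has_real_derivative f' a) (at a)"
      unfolding has_field_derivative_iff
    proof (rule filterlim_split_at_real)
      have "((\<lambda>y. (f y - f a) / (y - a)) \<longlongrightarrow> f' a) (at_left a)"
        using f[of a] filterlim_at_split unfolding has_field_derivative_iff by blast
      then show "((\<lambda>y. (?h y - ?h a) / (y - a)) \<longlongrightarrow> f' a) (at_left a)"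
        by (rule Lim_transform_eventually) (auto simp: eventually_at_filter)
      have "((\<lambda>y. (g y - g a) / (y - a)) \<longlongrightarrow> f' a) (at_right a)"
        using g[of a] filterlim_at_split eq(2) unfolding has_field_derivative_iff by fastforce
      then show "((\<lambda>y. (?h y - ?h a) / (y - a)) \<longlongrightarrow> f' a) (at_right a)"
        by (rule Lim_transform_eventually) (auto simp: eventually_at_filter eq(1))
    qed
    with 3 show ?thesis by simp
  qed
qed

lemma continuous_on_glue:
  fixes f g :: "real \<Rightarrow> real"
  assumes "continuous_on {..a} f" "continuous_on {a..} g" "f a = g a"
  shows "continuous_on UNIV (\<lambda>s. if s \<le> a then f s else g s)"
proof -
  have "continuous_on ({..a} \<union> {a..}) (\<lambda>s. if s \<le> a then f s else g s)"
    by (rule continuous_on_If) (use assms in auto)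
  moreover have "{..a} \<union> {a..} = UNIV" by auto
  ultimately show ?thesis by simp
qed

text \<open>One continuous derivative is enough for \<open>has_dbar\<close>. The square makes value
  and derivative vanish together at 1, and the primitive is explicit.\<close>

definition bump :: "real \<Rightarrow> real" where
  "bump s = (if s \<le> 1 then (1 - s)\<^sup>2 else 0)"

definition bump_deriv :: "real \<Rightarrow> real" where
  "bump_deriv s = (if s \<le> 1 then - 2 * (1 - s) else 0)"

text \<open>The mean of \<^const>\<open>bump\<close> over \<open>[0, s]\<close>.\<close>

definition bump_mean :: "real \<Rightarrow> real" where
  "bump_mean s = (if s \<le> 1 then 1 - s + s\<^sup>2 / 3 else 1 / (3 * s))"

definition bump_mean_deriv :: "real \<Rightarrow> real" where
  "bump_mean_deriv s = (if s \<le> 1 then - 1 + 2 * s / 3 else - 1 / (3 * s\<^sup>2))"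

lemma has_real_derivative_bump: "(bump has_real_derivative bump_deriv s) (at s)"
  unfolding bump_def[abs_def] bump_deriv_def
  by (rule has_real_derivative_glue) (auto intro!: derivative_eq_intros)

lemma has_real_derivative_bump_mean: "(bump_mean has_real_derivative bump_mean_deriv s) (at s)"
  unfolding bump_mean_def[abs_def] bump_mean_deriv_def
  by (rule has_real_derivative_glue) (auto intro!: derivative_eq_intros simp: field_simps power2_eq_square)

lemma continuous_on_bump_deriv: "continuous_on UNIV bump_deriv"
  unfolding bump_deriv_def[abs_def] by (rule continuous_on_glue) (auto intro!: continuous_intros)

lemma continuous_on_bump_mean_deriv: "continuous_on UNIV bump_mean_deriv"
  unfolding bump_mean_deriv_def[abs_def] by (rule continuous_on_glue) (auto intro!: continuous_intros)

lemma continuous_on_bump: "continuous_on UNIV bump"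
  by (meson continuous_at_imp_continuous_on DERIV_isCont has_real_derivative_bump)

text \<open>The derivative of s times the mean is the bump itself. This puts the bump into the form
  G + s G' of \<open>integral_exact_radial_eq_0\<close>.\<close>

lemma bump_mean_identity: "bump_mean s + s * bump_mean_deriv s = bump s"
  by (auto simp: bump_mean_def bump_mean_deriv_def bump_def power2_eq_square field_simps)

lemma bump_nonneg: "0 \<le> bump s"
  by (simp add: bump_def)

lemma bump_le_1: "0 \<le> s \<Longrightarrow> bump s \<le> 1"
  by (simp add: bump_def power_le_one)

lemma bump_eq_0: "1 < s \<Longrightarrow> bump s = 0"
  by (simp add: bump_def)

lemma bump_ge_quarter: "s \<le> 1 / 2 \<Longrightarrow> 1 / 4 \<le> bump s"
  using power_mono[of "1 / 2" "1 - s" 2] by (simp add: bump_def power2_eq_square)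

section \<open>The weighted mass and its dependence on the radii\<close>

context proper_system
begin

definition weight :: "('n \<Rightarrow> real) \<Rightarrow> complex ^ 'n \<Rightarrow> real" where
  "weight \<rho> x = (\<Prod>j\<in>UNIV. bump (sq j x / (\<rho> j)\<^sup>2))"

text \<open>For holomorphic Q and simple zeros, the value at unit radii is a positive constant times
  the global residue of Q, the sum of Q / J over the zeros of P.\<close>

definition mass :: "('n \<Rightarrow> real) \<Rightarrow> (complex ^ 'n \<Rightarrow> complex) \<Rightarrow> complex" where
  "mass \<rho> Q = integral\<^sup>L lborel (\<lambda>x. of_real (weight \<rho> x) * Q x * cnj (jac x))"

lemma continuous_on_weight: "continuous_on UNIV (weight \<rho>)"
  unfolding weight_def[abs_def] divide_inverse
  by (intro continuous_intros continuous_on_compose2[OF continuous_on_bump]) auto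

lemma continuous_on_jac: "continuous_on UNIV jac"
  by (rule has_dbar_imp_continuous_on[OF has_dbar_det_jacobian])

lemma weight_nonneg: "0 \<le> weight \<rho> x"
  unfolding weight_def by (intro prod_nonneg) (simp add: bump_nonneg)

lemma weight_le_1: "weight \<rho> x \<le> 1"
  unfolding weight_def by (intro prod_le_1) (simp add: bump_nonneg bump_le_1)

lemma weight_nonzeroD:
  assumes "weight \<rho> x \<noteq> 0" and "\<And>j. \<rho> j > 0"
  shows "cmod (peval (P j) x) \<le> \<rho> j"
proof (rule ccontr)
  assume "\<not> ?thesis"
  then have "sq j x > (\<rho> j)\<^sup>2"
    using assms(2)[of j] by (intro power_strict_mono) auto
  then have "bump (sq j x / (\<rho> j)\<^sup>2) = 0"
    using assms(2)[of j] by (intro bump_eq_0) simp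
  then show False using assms(1) by (auto simp: weight_def)
qed

lemma weight_bounded_support:
  assumes "\<And>j. \<rho> j > 0"
  obtains B where "\<And>x. norm x > B \<Longrightarrow> weight \<rho> x = 0"
proof -
  obtain B where B: "\<And>x. (\<forall>j. sq j x \<le> Max (range (\<lambda>j. (\<rho> j)\<^sup>2))) \<Longrightarrow> norm x \<le> B"
    using proper by blast
  have "weight \<rho> x = 0" if "norm x > B" for x
  proof (rule ccontr)
    assume "weight \<rho> x \<noteq> 0"
    then have "sq j x \<le> (\<rho> j)\<^sup>2" for j
      using weight_nonzeroD[OF _ assms] by (intro power_mono) auto
    then have "sq j x \<le> Max (range (\<lambda>j. (\<rho> j)\<^sup>2))" for j
      by (rule order_trans) auto
    then show False using B[of x] that by auto
  qed
  then show ?thesis using that by blast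
qed

lemma integrable_weight:
  fixes f :: "complex ^ 'n \<Rightarrow> 'b::{real_normed_algebra_1, euclidean_space}"
  assumes "\<And>j. \<rho> j > 0" and "continuous_on UNIV f"
  shows "integrable lborel (\<lambda>x. of_real (weight \<rho> x) * f x)"
proof -
  obtain B where "\<And>x. norm x > B \<Longrightarrow> weight \<rho> x = 0"
    using weight_bounded_support[of \<rho>] assms(1) by blast
  then show ?thesis
    by (intro integrable_continuous_bounded_support[where B = B] continuous_intros continuous_on_weight assms) auto
qed

text \<open>Apply \<open>integral_exact_radial_eq_0\<close> to the difference of the rescaled means
  \<open>?E\<close> for the old and the new squared radius. The corresponding G + s G' is the
  difference of the two normalized bumps, so the normalized masses agree.\<close>

lemma mass_update:
  assumes \<rho>: "\<And>j. \<rho> j > 0" and r: "r > 0" and Q: "has_dbar Q (\<lambda>_ _. 0)"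
  shows "mass \<rho> Q / of_real ((\<rho> i)\<^sup>2) = mass (\<rho>(i := r)) Q / of_real (r\<^sup>2)"
proof -
  let ?a = "(\<rho> i)\<^sup>2" and ?b = "r\<^sup>2"
  let ?E = "\<lambda>c s. bump_mean (s / c) / c" and ?E' = "\<lambda>c s. bump_mean_deriv (s / c) / c\<^sup>2"
  let ?h = "\<lambda>j s. bump (s / (\<rho> j)\<^sup>2)" and ?h' = "\<lambda>j s. bump_deriv (s / (\<rho> j)\<^sup>2) / (\<rho> j)\<^sup>2"
  define M where "M = max ?b (Max (range (\<lambda>j. (\<rho> j)\<^sup>2)))"
  have M: "(\<rho> j)\<^sup>2 \<le> M" "?b \<le> M" for j
    by (auto simp: M_def intro: max.coboundedI2)
  have pos: "?a > 0" "?b > 0" using \<rho>[of i] r by auto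
  have E: "(?E c has_real_derivative ?E' c s) (at s)" if "c > 0" for c s
    by (rule DERIV_cong[OF DERIV_cdivide[OF DERIV_chain2[OF has_real_derivative_bump_mean
            DERIV_cdivide[OF DERIV_ident]]]]) (simp add: power2_eq_square)
  have E': "continuous_on UNIV (?E' c)" if "c > 0" for c
    using that by (intro continuous_intros continuous_on_compose2[OF continuous_on_bump_mean_deriv]) auto
  \<comment> \<open>A single mean has no compact support, but its tail does not depend on
    \<open>c\<close>, so the difference of two vanishes beyond both squared radii.\<close>
  have E0: "?E c s = 1 / (3 * s)" if "s > c" "c > 0" for c s
    using that by (simp add: bump_mean_def field_simps)
  have EE: "?E c s + s * ?E' c s = bump (s / c) / c" if "c > 0" for c s
    using that bump_mean_identity[of "s / c"] by (simp add: field_simps power2_eq_square)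
  have "integral\<^sup>L lborel (\<lambda>x. of_real (((?E ?a (sq i x) - ?E ?b (sq i x)) +
          sq i x * (?E' ?a (sq i x) - ?E' ?b (sq i x))) *
           (\<Prod>j\<in>UNIV - {i}. ?h j (sq j x))) * Q x * cnj (jac x)) = 0"
  proof (rule integral_exact_radial_eq_0[where h' = ?h' and M = M])
    show "((\<lambda>s. ?E ?a s - ?E ?b s) has_real_derivative ?E' ?a s - ?E' ?b s) (at s)" for s
      by (rule DERIV_diff[OF E[OF pos(1)] E[OF pos(2)]])
    show "continuous_on UNIV (\<lambda>s. ?E' ?a s - ?E' ?b s)"
      by (rule continuous_on_diff[OF E'[OF pos(1)] E'[OF pos(2)]])
    show "(?h j has_real_derivative ?h' j s) (at s)" for j s
      by (rule DERIV_cong[OF DERIV_chain2[OF has_real_derivative_bump DERIV_cdivide[OF DERIV_ident]]]) simp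
    show "continuous_on UNIV (?h' j)" for j
      using \<rho>[of j] by (intro continuous_intros continuous_on_compose2[OF continuous_on_bump_deriv]) auto
    show "?E ?a s - ?E ?b s = 0" if "s > M" for s
      using that M(1)[of i] M(2) E0[of ?a s] E0[of ?b s] pos by auto
    show "?h j s = 0" if "s > M" for j s
      using that M(1)[of j] \<rho>[of j] by (intro bump_eq_0) simp
  qed (rule Q)
  also have "(\<lambda>x. of_real (((?E ?a (sq i x) - ?E ?b (sq i x)) +
          sq i x * (?E' ?a (sq i x) - ?E' ?b (sq i x))) *
           (\<Prod>j\<in>UNIV - {i}. ?h j (sq j x))) * Q x * cnj (jac x)) =
      (\<lambda>x. of_real (weight \<rho> x) * Q x * cnj (jac x) / of_real ?a -
        of_real (weight (\<rho>(i := r)) x) * Q x * cnj (jac x) / of_real ?b)"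
  proof
    fix x
    let ?H = "\<Prod>j\<in>UNIV - {i}. ?h j (sq j x)"
    have w: "weight \<rho> x = bump (sq i x / ?a) * ?H" "weight (\<rho>(i := r)) x = bump (sq i x / ?b) * ?H"
      by (simp_all add: weight_def prod.remove[where x = i])
    have "(?E ?a (sq i x) - ?E ?b (sq i x)) + sq i x * (?E' ?a (sq i x) - ?E' ?b (sq i x)) =
        bump (sq i x / ?a) / ?a - bump (sq i x / ?b) / ?b"
      using EE[OF pos(1), of "sq i x"] EE[OF pos(2), of "sq i x"] by (simp add: algebra_simps)
    then have "((?E ?a (sq i x) - ?E ?b (sq i x)) + sq i x * (?E' ?a (sq i x) - ?E' ?b (sq i x))) * ?H =
        weight \<rho> x / ?a - weight (\<rho>(i := r)) x / ?b"
      by (simp add: w left_diff_distrib)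
    then show "of_real (((?E ?a (sq i x) - ?E ?b (sq i x)) +
          sq i x * (?E' ?a (sq i x) - ?E' ?b (sq i x))) * ?H) * Q x * cnj (jac x) =
      of_real (weight \<rho> x) * Q x * cnj (jac x) / of_real ?a -
        of_real (weight (\<rho>(i := r)) x) * Q x * cnj (jac x) / of_real ?b"
      by (simp only: of_real_diff of_real_divide) (simp add: left_diff_distrib)
  qed
  also have "integral\<^sup>L lborel \<dots> = mass \<rho> Q / of_real ?a - mass (\<rho>(i := r)) Q / of_real ?b"
  proof -
    have c: "continuous_on UNIV (\<lambda>x. Q x * cnj (jac x))"
      by (intro continuous_intros has_dbar_imp_continuous_on[OF Q] continuous_on_jac)
    have "integrable lborel (\<lambda>x. of_real (weight \<rho> x) * Q x * cnj (jac x))"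
      "integrable lborel (\<lambda>x. of_real (weight (\<rho>(i := r)) x) * Q x * cnj (jac x))"
      using integrable_weight[OF _ c, of \<rho>] integrable_weight[OF _ c, of "\<rho>(i := r)"] \<rho> r
      by (simp_all add: mult.assoc)
    then show ?thesis unfolding mass_def by simp
  qed
  finally show ?thesis by simp
qed

text \<open>The radii are changed one at a time, by induction on a finite set containing all indices
  where \<rho> and \<sigma> differ.\<close>

lemma mass_normalized:
  assumes \<rho>: "\<And>j. \<rho> j > 0" and \<sigma>: "\<And>j. \<sigma> j > 0" and Q: "has_dbar Q (\<lambda>_ _. 0)"
  shows "mass \<rho> Q / of_real (\<Prod>j\<in>UNIV. (\<rho> j)\<^sup>2) = mass \<sigma> Q / of_real (\<Prod>j\<in>UNIV. (\<sigma> j)\<^sup>2)"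
proof -
  have "mass \<rho> Q / of_real (\<Prod>j\<in>UNIV. (\<rho> j)\<^sup>2) = mass \<sigma> Q / of_real (\<Prod>j\<in>UNIV. (\<sigma> j)\<^sup>2)"
    if "finite A" "\<And>j. j \<notin> A \<Longrightarrow> \<rho> j = \<sigma> j" "\<And>j. \<rho> j > 0" for A \<rho>
    using that
  proof (induction A arbitrary: \<rho> rule: finite_induct)
    case empty
    then have "\<rho> = \<sigma>" by auto
    then show ?case by simp
  next
    case (insert i A)
    let ?\<tau> = "\<rho>(i := \<sigma> i)"
    have "(\<Prod>j\<in>UNIV. (\<rho> j)\<^sup>2) = (\<rho> i)\<^sup>2 * (\<Prod>j\<in>UNIV - {i}. (\<rho> j)\<^sup>2)"
      "(\<Prod>j\<in>UNIV. (?\<tau> j)\<^sup>2) = (\<sigma> i)\<^sup>2 * (\<Prod>j\<in>UNIV - {i}. (\<rho> j)\<^sup>2)"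
      by (simp_all add: prod.remove[where x = i])
    then have "mass \<rho> Q / of_real (\<Prod>j\<in>UNIV. (\<rho> j)\<^sup>2) = mass ?\<tau> Q / of_real (\<Prod>j\<in>UNIV. (?\<tau> j)\<^sup>2)"
      using mass_update[where \<rho> = \<rho> and i = i and r = "\<sigma> i", OF insert.prems(2) \<sigma> Q]
      by (simp only: of_real_mult divide_divide_eq_left[symmetric])
    also have "\<dots> = mass \<sigma> Q / of_real (\<Prod>j\<in>UNIV. (\<sigma> j)\<^sup>2)"
      by (rule insert.IH) (use insert.prems \<sigma> in auto)
    finally show ?case .
  qed
  from this[of UNIV \<rho>] \<rho> show ?thesis by simp
qed

end

section \<open>Energy, and the mass for small and for large radii\<close>

lemma has_derivative_imp_eventually_Lipschitz:
  assumes "(f has_derivative f') (at a)"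
  obtains L where "L > 0" "eventually (\<lambda>x. norm (f x - f a) \<le> L * norm (x - a)) (nhds a)"
proof -
  from assms have lin: "bounded_linear f'"
    and "\<exists>d>0. \<forall>y. norm (y - a) < d \<longrightarrow> norm (f y - f a - f' (y - a)) \<le> 1 * norm (y - a)"
    unfolding has_derivative_at_alt by (blast intro: zero_less_one)+
  then obtain d where d: "d > 0"
    "\<And>y. norm (y - a) < d \<Longrightarrow> norm (f y - f a - f' (y - a)) \<le> norm (y - a)"
    by auto
  obtain K where K: "K > 0" "\<And>x. norm (f' x) \<le> norm x * K"
    using bounded_linear.pos_bounded[OF lin] by blast
  have "norm (f y - f a) \<le> (K + 1) * norm (y - a)" if "dist y a < d" for y
  proof -
    have "norm (f y - f a) \<le> norm (f y - f a - f' (y - a)) + norm (f' (y - a))"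
      using norm_triangle_sub[of "f y - f a" "f' (y - a)"] by (simp add: add.commute)
    also have "\<dots> \<le> norm (y - a) + norm (y - a) * K"
      using d(2)[of y] K(2)[of "y - a"] that by (intro add_mono) (auto simp: dist_norm)
    finally show ?thesis by (simp add: algebra_simps)
  qed
  then have "eventually (\<lambda>x. norm (f x - f a) \<le> (K + 1) * norm (x - a)) (nhds a)"
    using d(1) by (auto simp: eventually_nhds_metric)
  moreover have "K + 1 > 0" using K(1) by simp
  ultimately show ?thesis using that by blast
qed

context proper_system
begin

definition energy :: "('n \<Rightarrow> real) \<Rightarrow> real" where
  "energy \<rho> = integral\<^sup>L lborel (\<lambda>x. weight \<rho> x * (cmod (jac x))\<^sup>2)"

lemma energy_nonneg: "0 \<le> energy \<rho>"
  unfolding energy_def by (intro Bochner_Integration.integral_nonneg) (simp add: weight_nonneg)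

lemma integrable_energy:
  assumes "\<And>j. \<rho> j > 0"
  shows "integrable lborel (\<lambda>x. weight \<rho> x * (cmod (jac x))\<^sup>2)"
proof -
  have "continuous_on UNIV (\<lambda>x. (cmod (jac x))\<^sup>2)"
    by (intro continuous_intros continuous_on_jac)
  from integrable_weight[OF assms this] show ?thesis by simp
qed

lemma mass_scale:
  assumes "\<And>j. \<rho> j > 0" and "has_dbar Q (\<lambda>_ _. 0)"
  shows "mass \<rho> Q = of_real (\<Prod>j\<in>UNIV. (\<rho> j)\<^sup>2) * mass (\<lambda>_. 1) Q"
proof -
  have "(\<Prod>j\<in>UNIV. (\<rho> j)\<^sup>2) \<noteq> 0"
    using assms(1) by (simp add: less_imp_neq[symmetric])
  then have "complex_of_real (\<Prod>j\<in>UNIV. (\<rho> j)\<^sup>2) \<noteq> 0"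
    by (simp only: of_real_eq_0_iff not_False_eq_True)
  moreover have "mass \<rho> Q / of_real (\<Prod>j\<in>UNIV. (\<rho> j)\<^sup>2) = mass (\<lambda>_. 1) Q"
    using mass_normalized[of \<rho> "\<lambda>_. 1" Q] assms by simp
  ultimately show ?thesis
    by (metis nonzero_mult_div_cancel_left times_divide_eq_right)
qed

text \<open>J is holomorphic and the energy is its mass, so the scaling law of the mass
  applies.\<close>

lemma energy_scale:
  assumes "\<And>j. \<rho> j > 0"
  shows "energy \<rho> = (\<Prod>j\<in>UNIV. (\<rho> j)\<^sup>2) * energy (\<lambda>_. 1)"
proof -
  have "mass \<sigma> jac = of_real (energy \<sigma>)" for \<sigma>
  proof -
    have "(\<lambda>x. of_real (weight \<sigma> x) * jac x * cnj (jac x)) =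
        (\<lambda>x. complex_of_real (weight \<sigma> x * (cmod (jac x))\<^sup>2))"
      by (simp add: complex_norm_square mult.assoc del: of_real_power)
    then show ?thesis
      unfolding mass_def energy_def by (simp only: integral_complex_of_real)
  qed
  then have "complex_of_real (energy \<rho>) = of_real ((\<Prod>j\<in>UNIV. (\<rho> j)\<^sup>2) * energy (\<lambda>_. 1))"
    using mass_scale[where \<rho> = \<rho> and Q = jac, OF assms has_dbar_det_jacobian] by (simp only: of_real_mult)
  then show ?thesis by (simp only: of_real_eq_iff)
qed

text \<open>Let all radii be \<epsilon>, put g = Q / J and multiply the mass by the conjugate of
  g(\<alpha>). Near \<alpha> the integrand has positive real part, and a ball of radius proportional
  to \<epsilon> contributes a fixed multiple of \<epsilon>^(2n). Away from \<alpha>, |Q| is at most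
  \<eta> |J| on the support of the weight, so the loss is at most |g(\<alpha>)| \<eta> times the
  energy, which also scales as \<epsilon>^(2n). A small \<eta> lets the gain win, with no change of
  variables.\<close>

lemma mass_nonzero_if_isolated_value:
  assumes Q: "has_dbar Q (\<lambda>_ _. 0)"
    and \<alpha>: "\<And>j. peval (P j) \<alpha> = 0" "Q \<alpha> \<noteq> 0"
    and simple: "\<And>x. (\<And>j. peval (P j) x = 0) \<Longrightarrow> jac x \<noteq> 0"
    and others: "\<And>x. (\<And>j. peval (P j) x = 0) \<Longrightarrow> x \<noteq> \<alpha> \<Longrightarrow> Q x = 0"
  shows "mass (\<lambda>_. 1) Q \<noteq> 0"
proof
  assume mass0: "mass (\<lambda>_. 1) Q = 0"
  let ?n = "CARD('n)"
  have Re_of_real: "Re (of_real a * z) = a * Re z" for a z by simp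
  have contQ: "continuous_on UNIV Q" by (rule has_dbar_imp_continuous_on[OF Q])
  have J\<alpha>: "jac \<alpha> \<noteq> 0" using simple \<alpha>(1) by blast
  define g where "g x = Q x / jac x" for x
  have g\<alpha>: "g \<alpha> \<noteq> 0" using J\<alpha> \<alpha>(2) by (simp add: g_def)
  have isQ: "isCont Q \<alpha>" and isJ: "isCont jac \<alpha>"
    using contQ continuous_on_jac by (auto simp: continuous_on_eq_continuous_at)
  have isg: "isCont g \<alpha>"
    unfolding g_def[abs_def] by (intro continuous_intros isQ isJ J\<alpha>)
  have nhds_lim: "(f \<longlongrightarrow> f \<alpha>) (nhds \<alpha>)" if "isCont f \<alpha>" for f :: "complex ^ 'n \<Rightarrow> complex"
    using that by (simp add: isCont_def tendsto_at_iff_tendsto_nhds)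
  \<comment> \<open>A linear bound on the \<open>P j\<close> at their common zero \<alpha> ensures
    that the weight is not small on a ball of radius proportional to \<epsilon>.\<close>
  have "\<exists>L>0. eventually (\<lambda>x. cmod (peval (P j) x) \<le> L * norm (x - \<alpha>)) (nhds \<alpha>)" for j
    by (rule has_derivative_imp_eventually_Lipschitz[OF has_derivative_peval[of "P j" \<alpha>]])
       (auto simp: \<alpha>(1))
  then obtain L where L: "\<And>j. L j > 0"
    "\<And>j. eventually (\<lambda>x. cmod (peval (P j) x) \<le> L j * norm (x - \<alpha>)) (nhds \<alpha>)"
    by metis
  define K where "K = Max (range L)"
  have LK: "L j \<le> K" for j by (auto simp: K_def)
  have K0: "K > 0" using L(1) LK by (meson less_le_trans)
  have "eventually (\<lambda>x. \<forall>j. cmod (peval (P j) x) \<le> K * norm (x - \<alpha>)) (nhds \<alpha>)"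
  proof (rule eventually_all_finite)
    fix j
    show "eventually (\<lambda>x. cmod (peval (P j) x) \<le> K * norm (x - \<alpha>)) (nhds \<alpha>)"
      using L(2)[of j] by eventually_elim (meson LK mult_right_mono norm_ge_zero order_trans)
  qed
  moreover have "eventually (\<lambda>x. dist (g x) (g \<alpha>) < cmod (g \<alpha>) / 2) (nhds \<alpha>)"
    using g\<alpha> by (intro tendstoD nhds_lim[OF isg]) simp
  moreover have "eventually (\<lambda>x. dist (jac x) (jac \<alpha>) < cmod (jac \<alpha>) / 2) (nhds \<alpha>)"
    using J\<alpha> by (intro tendstoD nhds_lim[OF isJ]) simp
  ultimately have "eventually (\<lambda>x. (\<forall>j. cmod (peval (P j) x) \<le> K * norm (x - \<alpha>)) \<and>
      dist (g x) (g \<alpha>) < cmod (g \<alpha>) / 2 \<and> dist (jac x) (jac \<alpha>) < cmod (jac \<alpha>) / 2) (nhds \<alpha>)"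
    by eventually_elim simp
  then obtain r where r: "r > 0"
    and near: "\<And>x. dist x \<alpha> < r \<Longrightarrow> (\<forall>j. cmod (peval (P j) x) \<le> K * norm (x - \<alpha>)) \<and>
      dist (g x) (g \<alpha>) < cmod (g \<alpha>) / 2 \<and> dist (jac x) (jac \<alpha>) < cmod (jac \<alpha>) / 2"
    unfolding eventually_nhds_metric by blast
  have nearJ: "cmod (jac x) \<ge> cmod (jac \<alpha>) / 2" if "dist x \<alpha> < r" for x
    using near[OF that] norm_triangle_ineq2[of "jac \<alpha>" "jac x"] by (simp add: dist_norm norm_minus_commute)
  have nearJ0: "jac x \<noteq> 0" if "dist x \<alpha> < r" for x
    using nearJ[OF that] J\<alpha> by auto
  \<comment> \<open>Here Q = g J, so the expression is |J|^2 times
    \<open>cnj (g \<alpha>) * g x\<close>, and \<open>g x\<close> differs from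
    \<open>g \<alpha>\<close> by less than half of its modulus.\<close>
  have nearRe: "Re (cnj (g \<alpha>) * Q x * cnj (jac x)) \<ge> (cmod (g \<alpha>))\<^sup>2 / 2 * (cmod (jac x))\<^sup>2"
    if "dist x \<alpha> < r" for x
  proof -
    have "Re (cnj (g \<alpha>) * (g \<alpha> - g x)) \<le> cmod (cnj (g \<alpha>) * (g \<alpha> - g x))"
      by (rule complex_Re_le_cmod)
    also have "\<dots> \<le> cmod (g \<alpha>) * (cmod (g \<alpha>) / 2)"
      unfolding norm_mult complex_mod_cnj
      using near[OF that] by (intro mult_left_mono) (auto simp: dist_norm norm_minus_commute)
    finally have "Re (cnj (g \<alpha>) * g \<alpha>) - Re (cnj (g \<alpha>) * g x) \<le> (cmod (g \<alpha>))\<^sup>2 / 2"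
      by (simp add: right_diff_distrib power2_eq_square)
    moreover have "Re (cnj (g \<alpha>) * g \<alpha>) = (cmod (g \<alpha>))\<^sup>2"
      unfolding cmod_power2 by (simp add: power2_eq_square)
    ultimately have "Re (cnj (g \<alpha>) * g x) \<ge> (cmod (g \<alpha>))\<^sup>2 / 2" by simp
    moreover have "cnj (g \<alpha>) * Q x * cnj (jac x) = of_real ((cmod (jac x))\<^sup>2) * (cnj (g \<alpha>) * g x)"
      unfolding complex_norm_square using nearJ0[OF that] by (simp add: g_def)
    then have "Re (cnj (g \<alpha>) * Q x * cnj (jac x)) = (cmod (jac x))\<^sup>2 * Re (cnj (g \<alpha>) * g x)"
      by (simp only: Re_of_real)
    ultimately show ?thesis
      by (metis mult.commute mult_right_mono zero_le_power2)
  qed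
  \<comment> \<open>Lower bound for the integrand on the small ball: the first factor comes from
    \<open>nearRe\<close>, each bump is at least 1/4, and |J| is at least half of its value at
    \<alpha>.\<close>
  define c0 where "c0 = (cmod (g \<alpha>))\<^sup>2 / 2 * ((1 / 4) ^ ?n * (cmod (jac \<alpha>) / 2)\<^sup>2)"
  define V where "V = unit_ball_vol (real DIM(complex ^ 'n))"
  \<comment> \<open>On the ball of radius \<open>\<kappa> * \<epsilon>\<close> the linear bound
    gives |P_j| at most \<epsilon>/2, where \<open>bump_ge_quarter\<close> applies.\<close>
  define \<kappa> where "\<kappa> = 1 / (2 * K)"
  define E where "E = energy (\<lambda>_. 1)"
  \<comment> \<open>Chosen so that the loss \<open>cmod (g \<alpha>) * \<eta> * E\<close> stays
    below the gain from the ball; \<open>E + 1\<close> keeps the denominator positive.\<close>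
  define \<eta> where "\<eta> = c0 * (V * \<kappa> ^ (2 * ?n)) / (2 * (E + 1)) / cmod (g \<alpha>)"
  have c0: "c0 > 0" using g\<alpha> J\<alpha> by (simp add: c0_def)
  have V: "V > 0" by (simp add: V_def)
  have \<kappa>: "\<kappa> > 0" using K0 by (simp add: \<kappa>_def)
  have E: "E \<ge> 0" by (simp add: E_def energy_nonneg)
  have \<eta>: "\<eta> > 0" using c0 V \<kappa> E g\<alpha> by (simp add: \<eta>_def)
  have \<eta>E: "cmod (g \<alpha>) * \<eta> * E < c0 * (V * \<kappa> ^ (2 * ?n))"
  proof -
    let ?x = "c0 * (V * \<kappa> ^ (2 * ?n))"
    have x: "?x > 0" using c0 V \<kappa> by simp
    have "cmod (g \<alpha>) * \<eta> * E = ?x * (E / (2 * (E + 1)))"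
      using g\<alpha> by (simp add: \<eta>_def)
    also have "\<dots> < ?x * 1"
      using E x by (intro mult_strict_left_mono) (simp_all add: field_simps)
    finally show ?thesis by simp
  qed
  obtain B where B: "\<And>x. (\<forall>j. sq j x \<le> 1) \<Longrightarrow> norm x \<le> B"
    using proper by blast
  define S where "S x = (\<Sum>j\<in>UNIV. cmod (peval (P j) x))" for x
  \<comment> \<open>This compact set contains every point of the ball of radius \<open>B\<close>
    where the far estimate could fail. It contains no common zero, since at those other than
    \<alpha> Q vanishes and J does not; hence \<open>S\<close> has a positive lower bound on
    it.\<close>
  define X where "X = {x \<in> cball 0 B. r \<le> dist x \<alpha> \<and> \<eta> * cmod (jac x) \<le> cmod (Q x)}"
  have "compact X"
  proof -
    have "X = cball 0 B \<inter> {x. r \<le> dist x \<alpha>} \<inter> {x. \<eta> * cmod (jac x) \<le> cmod (Q x)}"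
      by (auto simp: X_def)
    then show ?thesis
      by (simp, intro compact_Int_closed closed_Collect_le continuous_intros contQ continuous_on_jac) auto
  qed
  have S0: "S x > 0" if "x \<in> X" for x
  proof -
    have "\<exists>j. peval (P j) x \<noteq> 0"
    proof (rule ccontr)
      assume *: "\<nexists>j. peval (P j) x \<noteq> 0"
      then have "x \<noteq> \<alpha>" using that r by (auto simp: X_def)
      with * others simple have "Q x = 0" "jac x \<noteq> 0" by auto
      with that \<eta> show False by (simp add: X_def mult_le_0_iff)
    qed
    then obtain j where "cmod (peval (P j) x) > 0" by auto
    then show ?thesis unfolding S_def by (intro sum_pos2[of _ j]) auto
  qed
  obtain \<epsilon>1 where \<epsilon>1: "\<epsilon>1 > 0" "\<And>x. x \<in> X \<Longrightarrow> \<epsilon>1 \<le> S x"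
  proof (cases "X = {}")
    case True
    then show ?thesis using that[of 1] by simp
  next
    case False
    have "continuous_on X S" unfolding S_def by (intro continuous_intros)
    then obtain x0 where "x0 \<in> X" "\<forall>x\<in>X. S x0 \<le> S x"
      using continuous_attains_inf[OF \<open>compact X\<close> False] by blast
    then show ?thesis using that[of "S x0"] S0 by blast
  qed
  \<comment> \<open>The three bounds keep the support of the weight inside the ball of radius
    \<open>B\<close>, keep it off \<open>X\<close>, and keep the small ball within distance
    \<open>r\<close> of \<alpha>.\<close>
  define \<epsilon> where "\<epsilon> = min (min 1 (\<epsilon>1 / (2 * ?n))) (r / (2 * \<kappa>))"
  have \<epsilon>: "\<epsilon> > 0" "\<epsilon> \<le> 1" "\<epsilon> \<le> \<epsilon>1 / (2 * ?n)" "\<epsilon> \<le> r / (2 * \<kappa>)"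
    using \<epsilon>1(1) r \<kappa> by (auto simp: \<epsilon>_def)
  let ?w = "weight (\<lambda>_. \<epsilon>)"
  have far: "cmod (Q x) \<le> \<eta> * cmod (jac x)" if w: "?w x \<noteq> 0" and x: "r \<le> dist x \<alpha>" for x
  proof -
    have Pj: "cmod (peval (P j) x) \<le> \<epsilon>" for j
      using weight_nonzeroD[OF w] \<epsilon>(1) by simp
    then have "sq j x \<le> 1" for j
      using \<epsilon>(2) by (meson norm_ge_zero order_trans power_le_one)
    then have "norm x \<le> B" using B by blast
    have "S x \<le> ?n * \<epsilon>"
      unfolding S_def using sum_bounded_above[of UNIV "\<lambda>j. cmod (peval (P j) x)" \<epsilon>] Pj by simp
    also have "\<dots> < \<epsilon>1"
      using \<epsilon>(3) \<epsilon>1(1) by (simp add: field_simps)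
    finally have "x \<notin> X" using \<epsilon>1(2)[of x] by auto
    then show ?thesis using x \<open>norm x \<le> B\<close> by (auto simp: X_def)
  qed
  let ?C = "cball \<alpha> (\<kappa> * \<epsilon>)"
  have C: "dist x \<alpha> < r" "?w x \<ge> (1 / 4) ^ ?n" if "x \<in> ?C" for x
  proof -
    have "\<kappa> * \<epsilon> < r" using \<epsilon>(4) \<kappa> r by (simp add: field_simps)
    then show *: "dist x \<alpha> < r" using that by (simp add: dist_commute)
    have "sq j x / \<epsilon>\<^sup>2 \<le> 1 / 2" for j
    proof -
      have "cmod (peval (P j) x) \<le> K * norm (x - \<alpha>)" using near[OF *] by blast
      also have "\<dots> \<le> K * (\<kappa> * \<epsilon>)"
        using that K0 by (intro mult_left_mono) (auto simp: dist_norm norm_minus_commute)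
      also have "\<dots> = \<epsilon> / 2" using K0 by (simp add: \<kappa>_def)
      finally have "sq j x \<le> (\<epsilon> / 2)\<^sup>2" by (rule power_mono) simp
      then have "sq j x \<le> \<epsilon>\<^sup>2 / 4" by (simp add: power_divide)
      then have "2 * sq j x \<le> \<epsilon>\<^sup>2"
        using zero_le_power2[of "cmod (peval (P j) x)"] by linarith
      then show ?thesis using \<epsilon>(1) by (simp add: field_simps)
    qed
    then have "1 / 4 \<le> bump (sq j x / \<epsilon>\<^sup>2)" for j
      by (rule bump_ge_quarter)
    then have "(\<Prod>j\<in>(UNIV :: 'n set). 1 / 4) \<le> ?w x"
      unfolding weight_def by (intro prod_mono) simp
    then show "?w x \<ge> (1 / 4) ^ ?n" by simp
  qed
  \<comment> \<open>Subtracting the error term everywhere gives one inequality valid at all points,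
    so the integral need not be split into near and far parts.\<close>
  have pointwise: "c0 * indicator ?C x - cmod (g \<alpha>) * \<eta> * (?w x * (cmod (jac x))\<^sup>2) \<le>
      Re (cnj (g \<alpha>) * (of_real (?w x) * Q x * cnj (jac x)))" for x
  proof -
    have e: "Re (cnj (g \<alpha>) * (of_real (?w x) * Q x * cnj (jac x))) =
        ?w x * Re (cnj (g \<alpha>) * Q x * cnj (jac x))"
      by (subst Re_of_real[symmetric]) (simp only: ac_simps)
    show ?thesis
    proof (cases "dist x \<alpha> < r")
      case True
      have "c0 * indicator ?C x \<le> ?w x * ((cmod (g \<alpha>))\<^sup>2 / 2 * (cmod (jac x))\<^sup>2)"
      proof (cases "x \<in> ?C")
        case True
        have "(1 / 4) ^ ?n * (cmod (jac \<alpha>) / 2)\<^sup>2 \<le> ?w x * (cmod (jac x))\<^sup>2"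
          using C[OF True] nearJ[of x] by (intro mult_mono power_mono weight_nonneg) auto
        then have "c0 \<le> (cmod (g \<alpha>))\<^sup>2 / 2 * (?w x * (cmod (jac x))\<^sup>2)"
          unfolding c0_def by (intro mult_left_mono) auto
        then show ?thesis using True by (simp add: mult_ac)
      qed (simp add: weight_nonneg)
      also have "\<dots> \<le> ?w x * Re (cnj (g \<alpha>) * Q x * cnj (jac x))"
        by (intro mult_left_mono nearRe True weight_nonneg)
      finally have "c0 * indicator ?C x \<le> ?w x * Re (cnj (g \<alpha>) * Q x * cnj (jac x))" .
      moreover have "0 \<le> cmod (g \<alpha>) * \<eta> * (?w x * (cmod (jac x))\<^sup>2)"
        using \<eta> weight_nonneg[of _ x] by simp
      ultimately show ?thesis unfolding e by linarith
    next
      case False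
      then have "x \<notin> ?C" using C(1) by blast
      have "- (cmod (g \<alpha>) * \<eta> * (?w x * (cmod (jac x))\<^sup>2)) \<le> ?w x * Re (cnj (g \<alpha>) * Q x * cnj (jac x))"
      proof (cases "?w x = 0")
        case w: False
        have "- Re (cnj (g \<alpha>) * Q x * cnj (jac x)) \<le> cmod (cnj (g \<alpha>) * Q x * cnj (jac x))"
          using abs_Re_le_cmod[of "cnj (g \<alpha>) * Q x * cnj (jac x)"] by linarith
        also have "\<dots> = cmod (g \<alpha>) * cmod (jac x) * cmod (Q x)" by (simp add: norm_mult mult_ac)
        also have "\<dots> \<le> cmod (g \<alpha>) * cmod (jac x) * (\<eta> * cmod (jac x))"
          using far[OF w] False by (intro mult_left_mono) auto
        finally have "?w x * (- Re (cnj (g \<alpha>) * Q x * cnj (jac x))) \<le>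
            ?w x * (cmod (g \<alpha>) * cmod (jac x) * (\<eta> * cmod (jac x)))"
          by (intro mult_left_mono weight_nonneg)
        then show ?thesis by (simp add: power2_eq_square algebra_simps)
      qed simp
      then show ?thesis unfolding e using \<open>x \<notin> ?C\<close> by simp
    qed
  qed
  have pos: "\<And>j::'n. \<epsilon> > 0" by (rule \<epsilon>(1))
  have vol: "measure lborel ?C = V * (\<kappa> * \<epsilon>) ^ (2 * ?n)"
    using \<kappa> \<epsilon>(1) content_cball[of "\<kappa> * \<epsilon>" \<alpha>] by (simp add: V_def mult.commute)
  have intC: "integrable lborel (\<lambda>x. c0 * indicator ?C x)"
    using emeasure_bounded_finite[OF bounded_cball, of \<alpha> "\<kappa> * \<epsilon>"]
    by (intro integrable_mult_right integrable_real_indicator) auto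
  have intE: "integrable lborel (\<lambda>x. cmod (g \<alpha>) * \<eta> * (?w x * (cmod (jac x))\<^sup>2))"
    by (intro integrable_mult_right integrable_energy \<epsilon>(1))
  have intM: "integrable lborel (\<lambda>x. of_real (?w x) * Q x * cnj (jac x))"
  proof -
    have "continuous_on UNIV (\<lambda>x. Q x * cnj (jac x))"
      by (intro continuous_intros contQ continuous_on_jac)
    from integrable_weight[OF pos this] show ?thesis by (simp add: mult.assoc)
  qed
  have energy_\<epsilon>: "energy (\<lambda>_. \<epsilon>) = \<epsilon> ^ (2 * ?n) * E"
    using energy_scale[OF pos] by (simp add: E_def power_mult)
  have "c0 * (V * (\<kappa> * \<epsilon>) ^ (2 * ?n)) - cmod (g \<alpha>) * \<eta> * energy (\<lambda>_. \<epsilon>) =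
      integral\<^sup>L lborel (\<lambda>x. c0 * indicator ?C x - cmod (g \<alpha>) * \<eta> * (?w x * (cmod (jac x))\<^sup>2))"
    using intC intE by (simp add: vol energy_def)
  also have "\<dots> \<le> integral\<^sup>L lborel (\<lambda>x. Re (cnj (g \<alpha>) * (of_real (?w x) * Q x * cnj (jac x))))"
    using intC intE intM
    by (intro integral_mono[OF Bochner_Integration.integrable_diff] integrable_Re pointwise)
       (simp_all only: integrable_mult_right)
  also have "\<dots> = Re (cnj (g \<alpha>) * mass (\<lambda>_. \<epsilon>) Q)"
    using intM by (simp only: mass_def integral_Re integrable_mult_right integral_mult_right_zero)
  also have "\<dots> = 0"
    using mass_scale[OF pos Q] mass0 by simp
  \<comment> \<open>Ball volume (real dimension 2n) and energy scale with the same power of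
    \<epsilon>, which cancels and contradicts the choice of \<eta>.\<close>
  finally have "c0 * (V * \<kappa> ^ (2 * ?n)) * \<epsilon> ^ (2 * ?n) \<le> cmod (g \<alpha>) * \<eta> * E * \<epsilon> ^ (2 * ?n)"
    by (simp add: energy_\<epsilon> power_mult_distrib mult_ac)
  then show False using \<eta>E \<epsilon>(1) by simp
qed

text \<open>Let s be the sum of the \<delta>_j. With radii a t^(\<delta>_j) the scaling law makes
  the mass grow exactly like t^(2s), unless it vanishes. On the support |Q| = O(t^e), and the
  estimate below gives O(t^(e+n+s)), which is smaller.\<close>

lemma mass_eq_0_if_growth:
  fixes \<delta> :: "'n \<Rightarrow> real"
  assumes Q: "has_dbar Q (\<lambda>_ _. 0)"
    and a: "a > 0"
    and small: "\<And>t x. t \<ge> T \<Longrightarrow> (\<And>j. cmod (peval (P j) x) \<le> a * t powr \<delta> j) \<Longrightarrow> sqrt (1 + (norm x)\<^sup>2) \<le> t"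
    and C: "C \<ge> 0" "\<And>x. cmod (Q x) \<le> C * sqrt (1 + (norm x)\<^sup>2) ^ e"
    and deg: "real e + CARD('n) + 1 \<le> (\<Sum>j\<in>UNIV. \<delta> j)"
  shows "mass (\<lambda>_. 1) Q = 0"
proof -
  let ?n = "CARD('n)"
  define s where "s = (\<Sum>j\<in>UNIV. \<delta> j)"
  define V where "V = unit_ball_vol (real DIM(complex ^ 'n))"
  define m where "m = cmod (mass (\<lambda>_. 1) Q)"
  define D where "D = C / 2 * (a ^ (2 * ?n) * energy (\<lambda>_. 1) + V)"
  have contQ: "continuous_on UNIV Q" by (rule has_dbar_imp_continuous_on[OF Q])
  have bound: "a ^ (2 * ?n) * m \<le> D / t" if t: "t \<ge> max 1 T" for t
  proof -
    have t1: "t \<ge> 1" "t > 0" "t \<ge> T" using t by auto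
    define \<rho> where "\<rho> j = a * t powr \<delta> j" for j
    have \<rho>: "\<rho> j > 0" for j using a t1 by (simp add: \<rho>_def)
    \<comment> \<open>The parameter in |J| \<le> (\<mu> |J|^2 + 1/\<mu>) / 2. It balances the
      energy, of order t^(2s), against the volume, of order t^(2n): both terms become
      t^(n+s).\<close>
    define \<mu> where "\<mu> = t powr (?n - s)"
    have \<mu>: "\<mu> > 0" "1 / \<mu> = t powr (s - ?n)"
      using t1 by (auto simp: \<mu>_def powr_minus_divide[symmetric])
    have prod: "(\<Prod>j\<in>UNIV. (\<rho> j)\<^sup>2) = a ^ (2 * ?n) * t powr (2 * s)"
    proof -
      have "(\<Prod>j\<in>UNIV. (\<rho> j)\<^sup>2) = (\<Prod>j\<in>UNIV. \<rho> j)\<^sup>2" by (rule prod_power_distrib[symmetric])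
      also have "(\<Prod>j\<in>UNIV. \<rho> j) = a ^ ?n * t powr s"
        using t1 by (simp add: \<rho>_def prod.distrib s_def powr_sum)
      also have "(a ^ ?n * t powr s)\<^sup>2 = a ^ (2 * ?n) * t powr (2 * s)"
        using t1 by (simp add: power_mult_distrib power_mult[symmetric] mult.commute powr_power)
      finally show ?thesis .
    qed
    have supp: "sqrt (1 + (norm x)\<^sup>2) \<le> t" if "weight \<rho> x \<noteq> 0" for x
      using weight_nonzeroD[OF that \<rho>] by (intro small t1) (simp add: \<rho>_def)
    have pointwise: "weight \<rho> x * cmod (Q x) * cmod (jac x) \<le> C * t ^ e / 2 *
        (\<mu> * (weight \<rho> x * (cmod (jac x))\<^sup>2) + 1 / \<mu> * indicator (cball 0 t) x)" for x
    proof (cases "weight \<rho> x = 0")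
      case True
      then show ?thesis using C(1) t1 \<mu>(1) by simp
    next
      case False
      note w = supp[OF False]
      have "norm x \<le> sqrt (1 + (norm x)\<^sup>2)" by (rule real_le_rsqrt) simp
      with w have x: "x \<in> cball 0 t" by simp
      have "cmod (Q x) \<le> C * t ^ e"
        using C(2)[of x] power_mono[OF w, of e] C(1) by (meson mult_left_mono order_trans real_sqrt_ge_zero
            add_nonneg_nonneg zero_le_one zero_le_power2)
      moreover have "cmod (jac x) \<le> (\<mu> * (cmod (jac x))\<^sup>2 + 1 / \<mu>) / 2"
      proof -
        have "0 \<le> (\<mu> * cmod (jac x) - 1)\<^sup>2 / \<mu>" using \<mu>(1) by simp
        also have "\<dots> = \<mu> * (cmod (jac x))\<^sup>2 - 2 * cmod (jac x) + 1 / \<mu>"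
          using \<mu>(1) by (simp add: power2_eq_square field_simps)
        finally show ?thesis by simp
      qed
      ultimately have "cmod (Q x) * cmod (jac x) \<le> C * t ^ e * ((\<mu> * (cmod (jac x))\<^sup>2 + 1 / \<mu>) / 2)"
        using C(1) t1 by (intro mult_mono) auto
      then have "weight \<rho> x * (cmod (Q x) * cmod (jac x)) \<le>
          weight \<rho> x * (C * t ^ e * ((\<mu> * (cmod (jac x))\<^sup>2 + 1 / \<mu>) / 2))"
        by (intro mult_left_mono weight_nonneg)
      also have "\<dots> = C * t ^ e / 2 * (\<mu> * (weight \<rho> x * (cmod (jac x))\<^sup>2) + 1 / \<mu> * weight \<rho> x)"
        by (simp add: algebra_simps)
      also have "\<dots> \<le> C * t ^ e / 2 * (\<mu> * (weight \<rho> x * (cmod (jac x))\<^sup>2) + 1 / \<mu> * indicator (cball 0 t) x)"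
        using C(1) t1 \<mu>(1) x weight_le_1[of \<rho> x]
        by (intro mult_left_mono add_left_mono) (auto simp: divide_right_mono)
      finally show ?thesis by (simp add: mult.assoc)
    qed
    have intM: "integrable lborel (\<lambda>x. weight \<rho> x * cmod (Q x) * cmod (jac x))"
    proof -
      have "continuous_on UNIV (\<lambda>x. cmod (Q x) * cmod (jac x))"
        by (intro continuous_intros contQ continuous_on_jac)
      from integrable_weight[OF \<rho> this] show ?thesis by (simp add: mult.assoc)
    qed
    have intE: "integrable lborel (\<lambda>x. \<mu> * (weight \<rho> x * (cmod (jac x))\<^sup>2))"
      by (intro integrable_mult_right integrable_energy \<rho>)
    have intC: "integrable lborel (\<lambda>x. 1 / \<mu> * indicator (cball (0 :: complex ^ 'n) t) x)"
      using emeasure_bounded_finite[OF bounded_cball, of "0 :: complex ^ 'n" t]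
      by (intro integrable_mult_right integrable_real_indicator) auto
    have "a ^ (2 * ?n) * m * t powr (2 * s) = cmod (mass \<rho> Q)"
      using a unfolding mass_scale[where \<rho> = \<rho>, OF \<rho> Q] prod
      by (simp add: norm_mult m_def norm_power)
    also have "\<dots> \<le> integral\<^sup>L lborel (\<lambda>x. cmod (of_real (weight \<rho> x) * Q x * cnj (jac x)))"
      unfolding mass_def by (rule integral_norm_bound)
    also have "\<dots> = integral\<^sup>L lborel (\<lambda>x. weight \<rho> x * cmod (Q x) * cmod (jac x))"
      by (simp add: norm_mult weight_nonneg)
    also have "\<dots> \<le> integral\<^sup>L lborel (\<lambda>x. C * t ^ e / 2 *
        (\<mu> * (weight \<rho> x * (cmod (jac x))\<^sup>2) + 1 / \<mu> * indicator (cball 0 t) x))"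
      by (intro integral_mono pointwise intM integrable_mult_right Bochner_Integration.integrable_add intE intC)
    also have "\<dots> = C * t ^ e / 2 * (integral\<^sup>L lborel (\<lambda>x. \<mu> * (weight \<rho> x * (cmod (jac x))\<^sup>2)) +
        integral\<^sup>L lborel (\<lambda>x. 1 / \<mu> * indicator (cball (0 :: complex ^ 'n) t) x))"
      by (simp only: integral_mult_right_zero Bochner_Integration.integral_add[OF intE intC])
    also have "\<dots> = C * t ^ e / 2 * (\<mu> * energy \<rho> + 1 / \<mu> * measure lborel (cball (0 :: complex ^ 'n) t))"
      by (simp add: energy_def)
    also have "measure lborel (cball (0 :: complex ^ 'n) t) = V * t powr (2 * ?n)"
      using t1 content_cball[of t "0 :: complex ^ 'n"] powr_realpow[of t "2 * ?n"]
      by (simp add: V_def mult.commute)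
    also have "energy \<rho> = a ^ (2 * ?n) * t powr (2 * s) * energy (\<lambda>_. 1)"
      using energy_scale[where \<rho> = \<rho>, OF \<rho>] prod by simp
    also have "C * t ^ e / 2 * (\<mu> * (a ^ (2 * ?n) * t powr (2 * s) * energy (\<lambda>_. 1)) +
        1 / \<mu> * (V * t powr (2 * ?n))) = D * t powr (e + ?n + s)"
    proof -
      have "\<mu> * t powr (2 * s) = t powr (?n + s)" "1 / \<mu> * t powr (2 * ?n) = t powr (?n + s)"
        unfolding \<mu>(2) by (simp_all add: \<mu>_def powr_add[symmetric] algebra_simps)
      note \<mu>_powr = this
      have "\<mu> * (a ^ (2 * ?n) * t powr (2 * s) * energy (\<lambda>_. 1)) + 1 / \<mu> * (V * t powr (2 * ?n)) =
          (\<mu> * t powr (2 * s)) * (a ^ (2 * ?n) * energy (\<lambda>_. 1)) + (1 / \<mu> * t powr (2 * ?n)) * V"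
        by (simp only: ac_simps)
      also have "\<dots> = (a ^ (2 * ?n) * energy (\<lambda>_. 1) + V) * t powr (?n + s)"
        unfolding \<mu>_powr by (simp add: algebra_simps)
      finally have "\<mu> * (a ^ (2 * ?n) * t powr (2 * s) * energy (\<lambda>_. 1)) + 1 / \<mu> * (V * t powr (2 * ?n)) =
          (a ^ (2 * ?n) * energy (\<lambda>_. 1) + V) * t powr (?n + s)" .
      moreover have "t ^ e * t powr (?n + s) = t powr (e + ?n + s)"
        using t1 by (simp add: powr_realpow[symmetric] powr_add[symmetric] add.assoc)
      ultimately show ?thesis by (simp add: D_def)
    qed
    \<comment> \<open>The degree bound e + n + 1 \<le> s enters here; the summand 1 is the source of
      the decay 1/t.\<close>
    also have "D * t powr (e + ?n + s) \<le> D * t powr (2 * s - 1)"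
      using C(1) t1 deg a energy_nonneg
      by (intro mult_left_mono powr_mono) (auto simp: D_def V_def s_def[symmetric])
    also have "\<dots> = D / t * t powr (2 * s)"
      using t1 by (simp add: powr_diff)
    finally show ?thesis
      by (rule mult_right_le_imp_le) (use t1 in simp)
  qed
  have "((\<lambda>t. D / t) \<longlongrightarrow> 0) at_top"
    by (rule tendsto_divide_0[OF tendsto_const filterlim_at_top_imp_at_infinity[OF filterlim_ident]])
  then have "a ^ (2 * ?n) * m \<le> 0"
    by (rule tendsto_lowerbound)
       (auto intro!: eventually_mono[OF eventually_ge_at_top[of "max 1 T"]] bound)
  then have "m \<le> 0" by (metis a mult_pos_pos not_le zero_less_power)
  then show ?thesis by (simp add: m_def)
qed

end

section \<open>Passage from the projective statement to the affine one\<close>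

lemma affine_embed_eq_iff: "affine_embed \<zeta> = affine_embed \<xi> \<longleftrightarrow> \<zeta> = \<xi>"
proof
  let ?e = "\<lambda>\<zeta>::complex^'a. (\<chi> v. case v of None \<Rightarrow> 1 | Some k \<Rightarrow> \<zeta> $ k) :: complex ^ 'a option"
  have nz: "?e \<zeta> \<noteq> 0" for \<zeta> by (auto simp: vec_eq_iff intro!: exI[of _ None])
  have refl: "proj_rel (?e \<zeta>) (?e \<zeta>)" for \<zeta>
    using nz[of \<zeta>] unfolding proj_rel_def by (auto intro!: exI[of _ 1])
  assume "affine_embed \<zeta> = affine_embed \<xi>"
  then have "proj_rel (?e \<zeta>) (?e \<xi>)"
    using Quotient3_rel[OF Quotient3_proj, of "?e \<zeta>" "?e \<xi>"] refl unfolding affine_embed_def by blast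
  then obtain c where c: "?e \<xi> = c *s ?e \<zeta>" unfolding proj_rel_def by blast
  \<comment> \<open>The coordinate X_0 equals 1 on both sides, which fixes the scalar.\<close>
  from arg_cong[OF c, of "\<lambda>v. v $ None"] have "c = 1" by simp
  show "\<zeta> = \<xi>"
    unfolding vec_eq_iff
  proof
    fix k
    from arg_cong[OF c, of "\<lambda>v. v $ Some k"] show "\<zeta> $ k = \<xi> $ k" using \<open>c = 1\<close> by simp
  qed
qed simp

theorem theorem4p1:
  fixes \<P> :: "'n::finite \<Rightarrow> 'n option cpoly"
    and P :: "'n \<Rightarrow> 'n cpoly"
    and d :: "'n \<Rightarrow> nat"
    and \<delta> :: "'n \<Rightarrow> rat"
    and c R :: real
    and Z Y :: "'n option proj set"
    and e :: nat
  assumes homog: "\<And>j. homogeneous (d j) (\<P> j)"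
    and P: "\<And>j. P j = dehomogenize (\<P> j)"
    and c: "c > 0" and R: "R > 0"
    and \<delta>: "\<And>j. 0 < \<delta> j \<and> \<delta> j \<le> of_nat (total_degree (P j))"
    and growth: "\<And>\<zeta>. norm \<zeta> \<ge> R \<Longrightarrow>
        (\<Sum>j\<in>UNIV. cmod (peval (P j) \<zeta>) / (1 + (norm \<zeta>)\<^sup>2) powr (of_rat (\<delta> j) / 2)) \<ge> c"
    and simple: "\<And>\<alpha>. (\<And>j. peval (P j) \<alpha> = 0) \<Longrightarrow> det (jacobian_matrix P \<alpha>) \<noteq> 0"
    and Z: "Z = (\<Inter>j. proj_zeros (\<P> j)) - proj_zeros (pvar None)"
    and Y: "is_hypersurface e Y"
    and deg: "of_nat e \<le> (\<Sum>j\<in>UNIV. \<delta> j) - of_nat CARD('n) - 1"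
    and all_but_one: "\<exists>z. Z - {z} \<subseteq> Y"
  shows "Z \<subseteq> Y"
proof -
  define n where "n = real CARD('n)"
  have n: "n > 0" by (simp add: n_def)
  \<comment> \<open>If every |P_j| is at most \<open>a\<close> times the matching growth factor, the
    sum in the growth hypothesis is at most n a = c/2, less than \<open>c\<close>.\<close>
  define a where "a = c / (2 * n)"
  have a: "a > 0" using c n by (simp add: a_def)
  define \<delta>' where "\<delta>' j = real_of_rat (\<delta> j)" for j
  have \<delta>': "\<delta>' j > 0" for j using \<delta>[of j] by (simp add: \<delta>'_def)
  \<comment> \<open>Growth turned into a support bound: were \<open>?s\<close> larger than
    \<open>t\<close>, positivity of the exponents would allow replacing \<open>t\<close> by
    \<open>?s\<close>, and the sum would fall below \<open>c\<close> outside the ball of radius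
    \<open>R\<close>.\<close>
  have small: "sqrt (1 + (norm x)\<^sup>2) \<le> t"
    if t: "t \<ge> sqrt (1 + R\<^sup>2)" and x: "\<And>j. cmod (peval (P j) x) \<le> a * t powr \<delta>' j" for t x
  proof (rule ccontr)
    let ?s = "sqrt (1 + (norm x)\<^sup>2)"
    assume *: "\<not> ?s \<le> t"
    have "0 < sqrt (1 + R\<^sup>2)" by (simp add: add_pos_nonneg)
    with t have t0: "t > 0" by linarith
    from * t have "sqrt (1 + R\<^sup>2) \<le> ?s" by linarith
    then have "R\<^sup>2 \<le> (norm x)\<^sup>2" by simp
    then have "R \<le> norm x" by (rule power2_le_imp_le) simp
    then have "c \<le> (\<Sum>j\<in>UNIV. cmod (peval (P j) x) / (1 + (norm x)\<^sup>2) powr (\<delta>' j / 2))"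
      using growth by (simp add: \<delta>'_def)
    also have "\<dots> \<le> (\<Sum>j\<in>(UNIV :: 'n set). a)"
    proof (rule sum_mono)
      fix j
      have "(1 + (norm x)\<^sup>2) powr (\<delta>' j / 2) = ?s powr \<delta>' j"
        using powr_half_sqrt[of "1 + (norm x)\<^sup>2"] powr_powr[of "1 + (norm x)\<^sup>2" "1 / 2" "\<delta>' j"] by simp
      moreover have "a * t powr \<delta>' j \<le> a * ?s powr \<delta>' j"
        using a * t0 \<delta>'[of j] by (intro mult_left_mono powr_mono2) auto
      moreover have "?s powr \<delta>' j > 0" using * t0 by auto
      ultimately show "cmod (peval (P j) x) / (1 + (norm x)\<^sup>2) powr (\<delta>' j / 2) \<le> a"
        using x[of j] by (simp add: pos_divide_le_eq)
    qed
    also have "\<dots> = c / 2" using n by (simp add: a_def n_def)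
    finally show False using c by simp
  qed
  interpret proper_system P
  proof
    fix M :: real
    have "eventually (\<lambda>t. \<forall>j. sqrt M \<le> a * t powr \<delta>' j) at_top"
    proof (rule eventually_all_finite)
      fix j
      \<comment> \<open>\<open>M\<close> is an arbitrary real and \<open>sqrt M\<close> may be
        negative; the maximum keeps the base of \<open>powr\<close> nonnegative.\<close>
      define b where "b = max 0 (sqrt M / a)"
      have "sqrt M \<le> a * t powr \<delta>' j" if "t \<ge> b powr (1 / \<delta>' j)" for t
      proof -
        have "sqrt M / a \<le> (b powr (1 / \<delta>' j)) powr \<delta>' j"
          using \<delta>'[of j] by (simp add: powr_powr b_def)
        also have "\<dots> \<le> t powr \<delta>' j"
          using that \<delta>'[of j] by (intro powr_mono2) auto
        finally show ?thesis using a by (simp add: field_simps)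
      qed
      then show "eventually (\<lambda>t. sqrt M \<le> a * t powr \<delta>' j) at_top"
        unfolding eventually_at_top_linorder by blast
    qed
    then have "eventually (\<lambda>t. t \<ge> sqrt (1 + R\<^sup>2) \<and> (\<forall>j. sqrt M \<le> a * t powr \<delta>' j)) at_top"
      using eventually_ge_at_top by (rule eventually_conj[rotated])
    then obtain t where t: "t \<ge> sqrt (1 + R\<^sup>2)" "\<And>j. sqrt M \<le> a * t powr \<delta>' j"
      by (auto simp: eventually_at_top_linorder)
    have "norm x \<le> t" if "\<forall>j. (cmod (peval (P j) x))\<^sup>2 \<le> M" for x
    proof -
      have "cmod (peval (P j) x) \<le> a * t powr \<delta>' j" for j
        using that t(2)[of j] real_le_rsqrt by (meson order_trans)
      then have "sqrt (1 + (norm x)\<^sup>2) \<le> t" by (rule small[OF t(1)])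
      moreover have "norm x \<le> sqrt (1 + (norm x)\<^sup>2)" by (rule real_le_rsqrt) simp
      ultimately show ?thesis by simp
    qed
    then show "\<exists>B. \<forall>x. (\<forall>j. (cmod (peval (P j) x))\<^sup>2 \<le> M) \<longrightarrow> norm x \<le> B" by blast
  qed
  obtain q where q: "homogeneous e q" "Y = proj_zeros q"
    using Y unfolding is_hypersurface_def by blast
  define Q where "Q = dehomogenize q"
  have Y_iff: "affine_embed \<zeta> \<in> Y \<longleftrightarrow> peval Q \<zeta> = 0" for \<zeta>
  proof -
    have "((\<chi> v. case v of None \<Rightarrow> 1 | Some k \<Rightarrow> \<zeta> $ k) :: complex ^ 'n option) \<noteq> 0"
      by (auto simp: vec_eq_iff intro!: exI[of _ None])
    then show ?thesis
      unfolding q(2) Q_def affine_embed_def peval_dehomogenize by (rule proj_pt_in_proj_zeros_iff[OF q(1)])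
  qed
  have Z_eq: "Z = affine_embed ` {\<zeta>. \<forall>j. peval (P j) \<zeta> = 0}"
    unfolding Z P using homog by (rule affine_part_eq)
  have "mass (\<lambda>_. 1) (peval Q) = 0"
  proof (rule mass_eq_0_if_growth[OF has_dbar_peval a])
    show "sqrt (1 + (norm x)\<^sup>2) \<le> t"
      if "t \<ge> sqrt (1 + R\<^sup>2)" "\<And>j. cmod (peval (P j) x) \<le> a * t powr \<delta>' j" for t x
      using that by (rule small)
    show "cmod (peval Q x) \<le> (\<Sum>m\<in>Poly_Mapping.keys q. cmod (Poly_Mapping.lookup q m)) *
        sqrt (1 + (norm x)\<^sup>2) ^ e" for x
      unfolding Q_def by (rule norm_peval_dehomogenize_le[OF q(1)])
    have "real_of_rat (of_nat e) \<le> real_of_rat ((\<Sum>j\<in>UNIV. \<delta> j) - of_nat CARD('n) - 1)"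
      using deg by (simp only: of_rat_less_eq)
    then show "real e + real CARD('n) + 1 \<le> (\<Sum>j\<in>UNIV. \<delta>' j)"
      by (simp add: of_rat_diff of_rat_sum \<delta>'_def)
  qed (simp add: sum_nonneg)
  show ?thesis
  proof
    fix z assume "z \<in> Z"
    then obtain \<alpha> where \<alpha>: "z = affine_embed \<alpha>" "\<And>j. peval (P j) \<alpha> = 0"
      by (auto simp: Z_eq)
    show "z \<in> Y"
    proof (rule ccontr)
      assume "z \<notin> Y"
      then have "peval Q \<alpha> \<noteq> 0" by (simp add: \<alpha>(1) Y_iff)
      \<comment> \<open>A point of Z outside Y must be the single exception, so Q vanishes at all
        other common zeros, and the two results on the mass contradict each other.\<close>
      moreover have "peval Q x = 0" if "\<And>j. peval (P j) x = 0" "x \<noteq> \<alpha>" for x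
      proof -
        have "affine_embed x \<in> Z" using that(1) by (auto simp: Z_eq)
        moreover have "affine_embed x \<noteq> z" using that(2) by (simp add: \<alpha>(1) affine_embed_eq_iff)
        ultimately have "affine_embed x \<in> Y"
          using all_but_one \<open>z \<in> Z\<close> \<open>z \<notin> Y\<close> by blast
        then show ?thesis by (simp add: Y_iff)
      qed
      ultimately have "mass (\<lambda>_. 1) (peval Q) \<noteq> 0"
        using mass_nonzero_if_isolated_value[OF has_dbar_peval \<alpha>(2)] simple by blast
      with \<open>mass (\<lambda>_. 1) (peval Q) = 0\<close> show False by contradiction
    qed
  qed
qed

end
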